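(* Let $N=N_1\circ N_2$ be a feedforward coalescence network with coalescence cell $c$, where $N_1,N_2$ have $n_1,n_2$ cells, let $F^N$ be an $N$-admissible diffusive system, with $F^{N_1},F^{N_2}$ the corresponding admissible systems of $N_1,N_2$, and let $(b_1,b_c):D_1\to\mathbb{R}^{n_1-1}\times\mathbb{R}$ be a bifurcation branch for $F^{N_1}$. Suppose that $\underline{\overline{J}}{}_F^{N_2}$ has rank $n_2-2$, that $(b_c)'(0)\,L_{N_2}^c\notin\operatorname{Im}(\underline{\overline{J}}{}_F^{N_2})$ and that $H\notin\operatorname{Im}(\underline{\overline{J}}{}_F^{N_2})$. Denote by $v\in\mathbb{R}^{n_2-1}$ a (nonzero) vector in the kernel of $\underline{\overline{J}}{}_F^{N_2}$. Then, generically, there exist $b_2^1,b_2^2:D_2\to\mathbb{R}^{n_2-1}$ such that $b^1=(b_1,b_c,b_2^1)$ and $b^2=(b_1,b_c,b_2^2)$, both maps $D_1\cap D_2\to\mathbb{R}^{n_1+n_2-1}$, are bifurcation branches for $F^N$. Furthermore, for any cell $d\in N_2$ such that $v_d\neq0$, the growth-rate of the bifurcation branches, $b^1_d$ and $b^2_d$, at cell $d$ is $\sqrt{|\lambda|}$.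
   Context: A (weighted, uniform) network $N$ with $n$ cells consists of a finite set $C$ of cells and a real weighted adjacency matrix $W_N=(w_{ij})$, where $w_{ij}$ is the weight of the edge from cell $j$ to cell $i$ ($0$ if there is no such edge; self-loops are allowed). Networks are assumed connected as undirected graphs. The input valency of cell $i$ is $v(i)=\sum_jw_{ij}$, $D_N$ is the diagonal matrix of input valencies, and the Laplacian is $L_N=D_N-W_N$. Coalescence: $N=N_1\circ N_2$ has cell set $C=C_1\cup C_2$ with $C_1\cap C_2=\{c\}$, and weights $w^N_{cc}=w^{N_1}_{cc}+w^{N_2}_{cc}$, and $w^N_{ab}=w^{N_i}_{ab}$ if $a,b\in C_i$ and $(a,b)\neq(c,c)$; all other weights are $0$. Cells are ordered so that $c$ is the last cell of $N_1$ and the first cell of $N_2$. $N$ is a feedforward coalescence network if, in $N_2$, the cell $c$ has no inputs from the other cells of $N_2$ (self-inputs are allowed). Given smooth $g:\mathbb{R}\times\mathbb{R}\to\mathbb{R}$ and $h:\mathbb{R}\times\mathbb{R}\times\mathbb{R}\to\mathbb{R}$, the admissible system $F^N$ of a network $N$ is $\dot x_i=f_i(x,\lambda)=g(x_i,\lambda)+\sum_jw_{ij}h(x_i,x_j,\lambda)$, with $\lambda\in\mathbb{R}$ the bifurcation parameter; $F^N,F^{N_1},F^{N_2}$ are defined by the same $g,h$. The system is diffusive if $h(z,z,\lambda)=0$ for all $z,\lambda$. With $g_0=\partial_xg$ and $h_1=\partial_{x_1}h$ at the origin, the Jacobian at the origin of a diffusive system of $N$ is $g_0\,\mathrm{id}+h_1L_N$;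 a bifurcation condition is $g_0+\mu h_1=0$ with $\mu$ an eigenvalue of $L_N$. Standing assumptions: the origin is an equilibrium for every $\lambda$; exactly one eigenvalue satisfies the bifurcation condition; and the bifurcation condition holds for both $N_1$ and $N_2$. "Generically" refers to generic $g$ and $h$. An equilibrium branch of $F^N$ is a map $b:D\to\mathbb{R}^n$ with $F^N(b(\lambda),\lambda)=0$ and $b(0)=0$, where $D$ has the form $]-\epsilon,\epsilon[$, $[0,\epsilon[$ or $]-\epsilon,0]$ for some $\epsilon>0$ ($D_1$ and $D_2$ are domains of such form); it is a bifurcation branch if $b\not\equiv0$. Notation: $L_{N_2}^c\in\mathbb{R}^{n_2-1}$ is the $c$-column of $L_{N_2}$ without the $c$-row; $\underline{\overline{J}}{}_F^{N_2}$ is the Jacobian at the origin of $F^{N_2}$ with the $c$-row and $c$-column removed; $H=\big(v^T\,\underline{\overline{H}}{}^{N_2}_{f_j}\,v\big)_{j\in C_2\setminus\{c\}}\in\mathbb{R}^{n_2-1}$, where $\underline{\overline{H}}{}^{N_2}_{f_j}$ is the Hessian matrix in $x$ at the origin of the component $f_j$ of $F^{N_2}$ with the $c$-row and $c$-column removed, and $v$ is a nonzero kernel vector of $\underline{\overline{J}}{}_F^{N_2}$ (unique up to scaling, which only rescales $H$). The coordinates of $v$ and of $b_2^1,b_2^2$ are indexed by the cells of $N_2$ other than $c$. Growth-rate $\sqrt{|\lambda|}$ means that the function is of order $\sqrt{|\lambda|}$ as $\lambda\to0$.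
   Formalization: A one-sided D_1 must lie on the side of λ=0 (fixed by N_2, g, h and b_c'(0)) where the new branches exist; on the other side D_1∩D_2={0} and the claim fails. Two-sided D_1 is fully covered. "Generically" is replaced by all smooth g, h meeting the stated conditions. *)

theory Defs
  imports "HOL-Analysis.Analysis" "HOL-Library.Landau_Symbols"
begin

section \<open>Smooth functions\<close>

primrec continuously_differentiable :: "nat \<Rightarrow> ('a::euclidean_space \<Rightarrow> real) \<Rightarrow> bool" where
  "continuously_differentiable 0 f \<longleftrightarrow> continuous_on UNIV f"
| "continuously_differentiable (Suc k) f \<longleftrightarrow>
     f differentiable_on UNIV \<and>
     (\<forall>e\<in>Basis. continuously_differentiable k (\<lambda>x. frechet_derivative f (at x) e))"

definition smooth :: "('a::euclidean_space \<Rightarrow> real) \<Rightarrow> bool" where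
  "smooth f \<longleftrightarrow> (\<forall>k. continuously_differentiable k f)"

definition hessian :: "(real^'n \<Rightarrow> real) \<Rightarrow> real^'n \<Rightarrow> real^'n^'n" where
  "hessian f x =
     (\<chi> i j. frechet_derivative (\<lambda>y. frechet_derivative f (at y) (axis j 1)) (at x) (axis i 1))"


section \<open>Weighted networks\<close>

text \<open>A network is given by its weighted adjacency matrix: \<open>W $ i $ j\<close> is the weight of the
  edge from cell \<open>j\<close> to cell \<open>i\<close>, and the cells are the elements of a finite type.\<close>

definition connected_network :: "real^'n^'n \<Rightarrow> bool" where
  "connected_network W \<longleftrightarrow> (\<forall>i j. (i, j) \<in> {(a, b). W $ a $ b \<noteq> 0 \<or> W $ b $ a \<noteq> 0}\<^sup>*)"

definition input_valency :: "real^'n^'n \<Rightarrow> 'n \<Rightarrow> real" where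
  "input_valency W i = (\<Sum>j\<in>UNIV. W $ i $ j)"

definition laplacian :: "real^'n^'n \<Rightarrow> real^'n^'n" where
  "laplacian W = (\<chi> i j. if i = j then input_valency W i else 0) - W"

definition eigenvalue :: "real^'n^'n \<Rightarrow> complex \<Rightarrow> bool" where
  "eigenvalue A \<mu> \<longleftrightarrow> (\<exists>x::complex^'n. x \<noteq> 0 \<and> map_matrix complex_of_real A *v x = \<mu> *s x)"


section \<open>Coalescence\<close>

text \<open>In \<open>N\<^sub>1 \<circ> N\<^sub>2\<close> the cells of \<open>N\<^sub>1\<close> form the type \<open>'p\<close>, with coalescence cell \<open>c :: 'p\<close>.
  The cells of \<open>N\<^sub>2\<close> form the type \<open>'q option\<close>, where \<open>None\<close> is the coalescence cell and
  \<open>'q\<close> consists of the other cells.  The cells of the coalescence form the type \<open>'p + 'q\<close>: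
  \<open>Inl i\<close> is the cell \<open>i\<close> of \<open>N\<^sub>1\<close>, \<open>Inr d\<close> is the cell \<open>Some d\<close> of \<open>N\<^sub>2\<close>, and \<open>None\<close> is
  identified with \<open>Inl c\<close>.\<close>

definition coalescence ::
    "'p::finite \<Rightarrow> real^'p^'p \<Rightarrow> real^('q::finite option)^('q option) \<Rightarrow> real^('p + 'q)^('p + 'q)" where
  "coalescence c W1 W2 = (\<chi> a b. case a of
      Inl i \<Rightarrow> (case b of
          Inl j \<Rightarrow> W1 $ i $ j + (if i = c \<and> j = c then W2 $ None $ None else 0)
        | Inr e \<Rightarrow> (if i = c then W2 $ None $ Some e else 0))
    | Inr d \<Rightarrow> (case b of
          Inl j \<Rightarrow> (if j = c then W2 $ Some d $ None else 0)
        | Inr e \<Rightarrow> W2 $ Some d $ Some e))"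

definition feedforward :: "real^('q::finite option)^('q option) \<Rightarrow> bool" where
  "feedforward W2 \<longleftrightarrow> (\<forall>d. W2 $ None $ Some d = 0)"

definition join :: "real^'p::finite \<Rightarrow> real^'q::finite \<Rightarrow> real^('p + 'q)" where
  "join x y = (\<chi> a. case a of Inl i \<Rightarrow> x $ i | Inr d \<Rightarrow> y $ d)"

text \<open>Removal of the row and the column of the coalescence cell, and the column of that cell
  without its own row.\<close>

definition without_c :: "real^('q::finite option)^('q option) \<Rightarrow> real^'q^'q" where
  "without_c A = (\<chi> d e. A $ Some d $ Some e)"

definition c_column :: "real^('q::finite option)^('q option) \<Rightarrow> real^'q" where
  "c_column A = (\<chi> d. A $ Some d $ None)"


section \<open>Admissible systems and bifurcation branches\<close>

definition admissible ::
    "(real \<times> real \<Rightarrow> real) \<Rightarrow> (real \<times> real \<times> real \<Rightarrow> real) \<Rightarrow> real^'n^'n \<Rightarrow>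
     real^'n \<Rightarrow> real \<Rightarrow> real^'n" where
  "admissible g h W x l =
     (\<chi> i. g (x $ i, l) + (\<Sum>j\<in>UNIV. W $ i $ j * h (x $ i, x $ j, l)))"

definition diffusive :: "(real \<times> real \<times> real \<Rightarrow> real) \<Rightarrow> bool" where
  "diffusive h \<longleftrightarrow> (\<forall>z l. h (z, z, l) = 0)"

definition bifurcation_condition ::
    "(real \<times> real \<Rightarrow> real) \<Rightarrow> (real \<times> real \<times> real \<Rightarrow> real) \<Rightarrow> complex \<Rightarrow> bool" where
  "bifurcation_condition g h \<mu> \<longleftrightarrow>
     complex_of_real (deriv (\<lambda>x. g (x, 0)) 0) +
       \<mu> * complex_of_real (deriv (\<lambda>x. h (x, 0, 0)) 0) = 0"

definition jacobian_origin :: "(real^'n \<Rightarrow> real \<Rightarrow> real^'n) \<Rightarrow> real^'n^'n" where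
  "jacobian_origin F = jacobian (\<lambda>x. F x 0) (at 0)"

definition hessian_vector ::
    "(real^('q::finite option) \<Rightarrow> real \<Rightarrow> real^('q option)) \<Rightarrow> real^'q \<Rightarrow> real^'q" where
  "hessian_vector F v =
     (\<chi> d. v \<bullet> (without_c (hessian (\<lambda>x. F x 0 $ Some d) 0) *v v))"

definition branch_domain :: "real set \<Rightarrow> bool" where
  "branch_domain D \<longleftrightarrow> (\<exists>\<epsilon>>0. D = {-\<epsilon><..<\<epsilon>} \<or> D = {0..<\<epsilon>} \<or> D = {-\<epsilon><..0})"

definition equilibrium_branch ::
    "(real^'n \<Rightarrow> real \<Rightarrow> real^'n) \<Rightarrow> real set \<Rightarrow> (real \<Rightarrow> real^'n) \<Rightarrow> bool" where
  "equilibrium_branch F D b \<longleftrightarrow> branch_domain D \<and> (\<forall>l\<in>D. F (b l) l = 0) \<and> b 0 = 0"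

definition bifurcation_branch ::
    "(real^'n \<Rightarrow> real \<Rightarrow> real^'n) \<Rightarrow> real set \<Rightarrow> (real \<Rightarrow> real^'n) \<Rightarrow> bool" where
  "bifurcation_branch F D b \<longleftrightarrow> equilibrium_branch F D b \<and> (\<exists>l\<in>D. b l \<noteq> 0)"

text \<open>Two conventions for statements about branches of a coalescence.

  Genericity: the exact non-degeneracy conditions are stated as hypotheses, for arbitrary smooth
  \<open>g\<close> and \<open>h\<close>.  The condition \<open>h\<^sub>1 \<noteq> 0\<close> need not be listed.  If \<open>h\<^sub>1 = 0\<close>, a bifurcation condition
  forces \<open>g\<^sub>0 = 0\<close>, so the Jacobian vanishes and rank \<open>n\<^sub>2 - 2\<close> means \<open>n\<^sub>2 = 2\<close>; then \<open>0\<close> and the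
  (nonzero) weight of the edge leaving the coalescence cell are two eigenvalues of the Laplacian
  of the coalescence that satisfy the bifurcation condition, against uniqueness.

  Side of the bifurcation: a branch growing like \<open>\<surd>|\<lambda>|\<close> lives on one side of \<open>\<lambda> = 0\<close>, and which
  side is determined by \<open>N\<^sub>2\<close>, \<open>g\<close>, \<open>h\<close> and \<open>b\<^sub>c'(0)\<close>.  A branch of \<open>N\<^sub>1\<close> whose domain \<open>D\<^sub>1\<close> lies
  entirely on the other side gives \<open>D\<^sub>1 \<inter> D\<^sub>2 = {0}\<close>, which is not a branch domain; such \<open>D\<^sub>1\<close>
  have to be excluded, whereas a two-sided \<open>D\<^sub>1\<close> meets either side.\<close>

end

theory Submission
  imports Defs
begin

text \<open>Since \<open>c\<close> has no inputs from \<open>N\<^sub>2\<close>, a branch of \<open>N\<^sub>1\<close> extends to \<open>N\<close> as soon as the cells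
  \<open>y\<close> of \<open>N\<^sub>2\<close> other than \<open>c\<close> solve \<open>G(y, b\<^sub>c(\<lambda>), \<lambda>) = 0\<close>.  The equation is blown up: with
  \<open>r = \<surd>|\<lambda>|\<close>, \<open>\<lambda> = \<sigma> r\<^sup>2\<close>, \<open>a(u) = (u \<bullet> v) / (v \<bullet> v)\<close> and \<open>y = r a(u) v + r\<^sup>2 u\<close>, the second order
  Taylor expansion shows that \<open>G / r\<^sup>2\<close> tends, uniformly for bounded \<open>u\<close>, to
  \<open>J u + \<sigma> \<beta> k + (a(u)\<^sup>2 / 2) H\<close>, where \<open>k = h\<^sub>1 L\<^sup>c\<close>.  As \<open>J\<close> has corank one and neither \<open>\<beta> k\<close> nor
  \<open>H\<close> lies in its image, for exactly one sign \<open>\<sigma>\<close> the limit has zeros; they have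
  \<open>a(u) = \<plusminus>\<alpha> \<noteq> 0\<close>, and the derivative there is invertible.  Brouwer's fixed
  point theorem makes these zeros persist for small \<open>r\<close> without any regularity of \<open>b\<^sub>c\<close> beyond
  differentiability at \<open>0\<close>, and \<open>y = \<plusminus>\<alpha> r v + o(r)\<close> is the growth rate.\<close>


section \<open>Persistence of zeros and the blown-up equation\<close>

text \<open>With \<open>B\<close> the inverse of \<open>T'\<close>, a zero of \<open>T\<close> is a
  fixed point of \<open>u - B (T u)\<close>. On a small ball the linearization error of
  \<open>T\<^sub>0\<close> and the perturbation each move the image by at most half the radius, so
  Brouwer applies. \<open>r\<close> and \<open>\<delta>\<close> come before \<open>T\<close>, so one
  pair serves all parameter values; \<open>\<rho>\<close> lets the caller localize the zero.\<close>

lemma perturbed_zero_exists: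
  fixes T\<^sub>0 :: "'a::euclidean_space \<Rightarrow> 'a"
  assumes der: "(T\<^sub>0 has_derivative T') (at u\<^sub>0)" and zero: "T\<^sub>0 u\<^sub>0 = 0"
    and surj: "surj T'" and "\<rho> > 0"
  obtains r \<delta> where "0 < r" "r \<le> \<rho>" "0 < \<delta>"
    "\<And>T. continuous_on (cball u\<^sub>0 r) T \<Longrightarrow> (\<And>u. u \<in> cball u\<^sub>0 r \<Longrightarrow> norm (T u - T\<^sub>0 u) \<le> \<delta>)
      \<Longrightarrow> \<exists>u\<in>cball u\<^sub>0 r. T u = 0"
proof -
  have lin: "linear T'"
    using der has_derivative_bounded_linear bounded_linear.linear by blast
  obtain B where B: "linear B" "\<And>x. B (T' x) = x" "\<And>x. T' (B x) = x"
    using linear_surjective_isomorphism[OF lin surj] by auto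
  obtain K where K: "K > 0" "\<And>x. norm (B x) \<le> K * norm x"
    using linear_bounded_pos[OF B(1)] by auto
  \<comment> \<open>The bound \<open>K\<close> of \<open>B\<close> turns the factor
    \<open>1 / (2*K)\<close> into 1/2; the definition of \<open>\<delta>\<close> below claims the
    other half of the radius.\<close>
  obtain d where d: "d > 0" "\<And>y. norm (y - u\<^sub>0) < d \<Longrightarrow>
      norm (T\<^sub>0 y - T\<^sub>0 u\<^sub>0 - T' (y - u\<^sub>0)) \<le> 1 / (2*K) * norm (y - u\<^sub>0)"
    using der K(1) unfolding has_derivative_at_alt
    by (auto dest!: spec[of _ "1 / (2*K)"])
  define r where "r = min \<rho> (d/2)"
  have r: "0 < r" "r \<le> \<rho>" "r < d" using d \<open>\<rho> > 0\<close> by (auto simp: r_def)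
  define \<delta> where "\<delta> = r / (2*K)"
  have \<delta>: "\<delta> > 0" using r K by (simp add: \<delta>_def)
  have "\<exists>u\<in>cball u\<^sub>0 r. T u = 0"
    if cont: "continuous_on (cball u\<^sub>0 r) T"
      and close: "\<And>u. u \<in> cball u\<^sub>0 r \<Longrightarrow> norm (T u - T\<^sub>0 u) \<le> \<delta>" for T
  proof -
    have "continuous_on (cball u\<^sub>0 r) (\<lambda>u. u - B (T u))"
      by (intro continuous_on_diff continuous_on_id linear_continuous_on_compose[OF cont B(1)])
    moreover have "u - B (T u) \<in> cball u\<^sub>0 r" if u: "u \<in> cball u\<^sub>0 r" for u
    proof -
      have nu: "norm (u - u\<^sub>0) \<le> r" using u by (simp add: dist_norm norm_minus_commute)
      \<comment> \<open>\<open>B\<close> undoes the linear part \<open>T' (u - u\<^sub>0)\<close>,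
        which leaves only the nonlinear remainder and the perturbation.\<close>
      have "u - B (T u) - u\<^sub>0 = - B (T\<^sub>0 u - T\<^sub>0 u\<^sub>0 - T' (u - u\<^sub>0)) - B (T u - T\<^sub>0 u)"
        by (simp add: linear_diff[OF B(1)] B(2) zero linear_0[OF B(1)])
      then have "norm (u - B (T u) - u\<^sub>0) \<le>
          norm (B (T\<^sub>0 u - T\<^sub>0 u\<^sub>0 - T' (u - u\<^sub>0))) + norm (B (T u - T\<^sub>0 u))"
        using norm_triangle_ineq4[of "- B (T\<^sub>0 u - T\<^sub>0 u\<^sub>0 - T' (u - u\<^sub>0))" "B (T u - T\<^sub>0 u)"]
        by (simp only: norm_minus_cancel)
      also have "\<dots> \<le> K * (1/(2*K) * r) + K * \<delta>"
      proof (intro add_mono)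
        have "norm (T\<^sub>0 u - T\<^sub>0 u\<^sub>0 - T' (u - u\<^sub>0)) \<le> 1 / (2*K) * norm (u - u\<^sub>0)"
          using d(2) nu r by simp
        also have "\<dots> \<le> 1/(2*K) * r" using nu K(1) by (intro mult_left_mono) auto
        finally show "norm (B (T\<^sub>0 u - T\<^sub>0 u\<^sub>0 - T' (u - u\<^sub>0))) \<le> K * (1/(2*K) * r)"
          using K(1) by (intro order_trans[OF K(2)] mult_left_mono) auto
        show "norm (B (T u - T\<^sub>0 u)) \<le> K * \<delta>"
          using K(1) close[OF u] by (intro order_trans[OF K(2)] mult_left_mono) auto
      qed
      also have "\<dots> = r" using K(1) by (simp add: \<delta>_def)
      finally show ?thesis by (simp add: dist_norm norm_minus_commute)
    qed
    ultimately obtain u where u: "u \<in> cball u\<^sub>0 r" "u - B (T u) = u"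
      using brouwer[of "cball u\<^sub>0 r" "\<lambda>u. u - B (T u)"] r(1) by (auto simp: Pi_def)
    have "T u = T' (B (T u))" by (simp add: B(3))
    also have "\<dots> = 0" using u(2) linear_0[OF lin] by simp
    finally show ?thesis using u(1) by blast
  qed
  then show thesis using that r \<delta> by blast
qed

text \<open>The weights in \<open>taylor\<close> fit the scaling: for \<open>y\<close> of order sqrt
  |l| and \<open>s\<close> of order |l| the error is o(|l|). Solutions are found separately for
  every pair \<open>l\<close>, \<open>s\<close> with \<open>s\<close> close to
  \<open>\<beta> * l\<close>, so any function s = \<beta> l + o(l) can be inserted later.
  \<open>\<sigma>\<close> and \<open>\<alpha>\<close> precede \<open>\<tau>\<close>, so both signs
  of \<open>\<tau>\<close> give solutions on the same side.\<close>

lemma fold_solutions: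
  fixes G :: "'a::euclidean_space \<Rightarrow> real \<Rightarrow> real \<Rightarrow> 'a"
  assumes J: "linear J" and Jv: "J v = 0" and v: "v \<noteq> 0"
    and Qcont: "continuous_on UNIV Q" and Qhom: "\<And>r y. Q (r *\<^sub>R y) = r\<^sup>2 *\<^sub>R Q y"
    and Qspan: "span (insert (Q v) (range J)) = UNIV"
    and k: "\<beta> *\<^sub>R k \<notin> range J"
    and cont: "\<And>s l. continuous_on UNIV (\<lambda>y. G y s l)"
    and taylor: "\<And>\<epsilon>. \<epsilon> > 0 \<Longrightarrow> \<exists>\<delta>>0. \<forall>y s l. norm y \<le> \<delta> \<and> \<bar>s\<bar> \<le> \<delta> \<and> \<bar>l\<bar> \<le> \<delta> \<longrightarrow>
      norm (G y s l - (J y + s *\<^sub>R k + (1/2) *\<^sub>R Q y)) \<le> \<epsilon> * ((norm y)\<^sup>2 + \<bar>s\<bar> + \<bar>l\<bar>)"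
  obtains \<sigma> \<alpha> :: real where "\<sigma> \<in> {1, -1}" "\<alpha> > 0"
    "\<And>\<tau> \<epsilon>. \<tau> \<in> {1, -1} \<Longrightarrow> \<epsilon> > 0 \<Longrightarrow>
      \<exists>r>0. \<forall>l s. 0 < \<sigma> * l \<and> \<bar>l\<bar> < r \<and> \<bar>s - \<beta> * l\<bar> \<le> r * \<bar>l\<bar> \<longrightarrow>
        (\<exists>y. G y s l = 0 \<and> norm (y - (\<tau> * \<alpha> * sqrt \<bar>l\<bar>) *\<^sub>R v) \<le> \<epsilon> * sqrt \<bar>l\<bar>)"
proof -
  \<comment> \<open>Modulo \<open>range J\<close> every vector is a multiple of \<open>Q v\<close>;
    the coefficient \<open>t\<close> of \<open>\<beta> *\<^sub>R k\<close> then decides the side of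
    the bifurcation.\<close>
  have split: "\<exists>z t. x = J z + t *\<^sub>R Q v" for x
  proof -
    have "x \<in> span (insert (Q v) (range J))" using Qspan by simp
    then obtain t where "x - t *\<^sub>R Q v \<in> span (range J)"
      by (auto simp: span_insert)
    moreover have "span (range J) = range J"
      by (simp add: J linear_subspace_image span_eq_iff)
    ultimately obtain z where "x - t *\<^sub>R Q v = J z" by auto
    then have "x = J z + t *\<^sub>R Q v" by (simp add: algebra_simps)
    then show ?thesis by blast
  qed
  obtain z\<^sub>0 t where z0: "\<beta> *\<^sub>R k = J z\<^sub>0 + t *\<^sub>R Q v" using split by blast
  have t: "t \<noteq> 0" using k z0 by auto
  \<comment> \<open>The coefficient of \<open>Q v\<close> in the limit equation is \<sigma> t +
    a(u)^2 / 2. It can vanish with a(u) nonzero only for \<sigma> = - sgn t, and then a(u) is plus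
    or minus sqrt (2 |t|).\<close>
  define \<sigma> where "\<sigma> = - sgn t"
  define \<alpha> where "\<alpha> = sqrt (2 * \<bar>t\<bar>)"
  have \<sigma>: "\<sigma> \<in> {1, -1}" using t by (auto simp: \<sigma>_def sgn_real_def)
  have \<alpha>: "\<alpha> > 0" "\<alpha>\<^sup>2 / 2 = - \<sigma> * t" using t by (auto simp: \<alpha>_def \<sigma>_def sgn_real_def)
  define a where "a u = (u \<bullet> v) / (v \<bullet> v)" for u
  have vv: "v \<bullet> v > 0" using v by simp
  have alin: "a (x + y) = a x + a y" "a (x - y) = a x - a y" "a (b *\<^sub>R x) = b * a x" "a v = 1" for x y b
    using vv by (auto simp: a_def inner_add_left inner_diff_left add_divide_distrib diff_divide_distrib)
  have anorm: "\<bar>a u\<bar> * norm v \<le> norm u" for u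
  proof -
    have "\<bar>a u\<bar> * norm v * norm v = \<bar>u \<bullet> v\<bar>"
      using vv v by (simp add: a_def abs_divide power2_norm_eq_inner[symmetric] power2_eq_square)
    also have "\<dots> \<le> norm u * norm v" by (rule Cauchy_Schwarz_ineq2)
    finally show ?thesis using v by simp
  qed
  have ader: "(a has_derivative a) (at u)" for u
    using v unfolding a_def by (auto intro!: derivative_eq_intros)
  define T\<^sub>0 where "T\<^sub>0 u = J u + (\<sigma> * \<beta>) *\<^sub>R k + ((a u)\<^sup>2 / 2) *\<^sub>R Q v" for u
  have "\<exists>r>0. \<forall>l s. 0 < \<sigma> * l \<and> \<bar>l\<bar> < r \<and> \<bar>s - \<beta> * l\<bar> \<le> r * \<bar>l\<bar> \<longrightarrow>
        (\<exists>y. G y s l = 0 \<and> norm (y - (\<tau> * \<alpha> * sqrt \<bar>l\<bar>) *\<^sub>R v) \<le> \<epsilon> * sqrt \<bar>l\<bar>)"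
    if \<tau>: "\<tau> \<in> {1, -1}" and \<epsilon>: "\<epsilon> > 0" for \<tau> \<epsilon> :: real
  proof -
    \<comment> \<open>The term with \<open>z\<^sub>0\<close> cancels the part of
      \<open>(\<sigma> * \<beta>) *\<^sub>R k\<close> in \<open>range J\<close>; the multiple of
      \<open>v\<close>, invisible to \<open>J\<close>, adjusts \<open>a u\<^sub>0\<close> to
      \<open>\<tau> * \<alpha>\<close>.\<close>
    define u\<^sub>0 where "u\<^sub>0 = (- \<sigma>) *\<^sub>R z\<^sub>0 + (\<tau> * \<alpha> + \<sigma> * a z\<^sub>0) *\<^sub>R v"
    have au0: "a u\<^sub>0 = \<tau> * \<alpha>" by (simp add: u\<^sub>0_def alin)
    have "(a u\<^sub>0)\<^sup>2 / 2 = - \<sigma> * t" using \<alpha>(2) \<tau> by (auto simp: au0 power_mult_distrib)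
    moreover have "J u\<^sub>0 = - \<sigma> *\<^sub>R J z\<^sub>0"
      by (simp add: u\<^sub>0_def linear_diff[OF J] linear_scale[OF J] Jv)
    ultimately have zero: "T\<^sub>0 u\<^sub>0 = 0"
      unfolding T\<^sub>0_def scaleR_scaleR[symmetric] z0 by (simp add: scaleR_add_right)
    define T' where "T' u = J u + (a u\<^sub>0 * a u) *\<^sub>R Q v" for u
    have Jder: "(J has_derivative J) (at u\<^sub>0)"
      using J linear_conv_bounded_linear linear_imp_has_derivative by blast
    have der: "(T\<^sub>0 has_derivative T') (at u\<^sub>0)"
      unfolding T\<^sub>0_def[abs_def] T'_def[abs_def]
      by (rule derivative_eq_intros Jder ader refl | simp add: mult.commute)+
    \<comment> \<open>Moving along \<open>v\<close> leaves the \<open>J\<close> part alone and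
      changes the coefficient of \<open>Q v\<close> freely, because \<open>a u\<^sub>0\<close> is
      nonzero.\<close>
    have "x \<in> range T'" for x
    proof -
      obtain z p where zp: "x = J z + p *\<^sub>R Q v" using split by blast
      have "a u\<^sub>0 \<noteq> 0" using au0 \<tau> \<alpha> by auto
      then have "T' (z + (p / a u\<^sub>0 - a z) *\<^sub>R v) = x"
        by (simp add: T'_def linear_add[OF J] linear_scale[OF J] Jv alin zp)
      then show ?thesis by blast
    qed
    then have surj: "surj T'" by blast
    \<comment> \<open>Half of \<open>\<epsilon>\<close> bounds the distance of the zero from
      \<open>u\<^sub>0\<close>; the other half is kept for the higher order part
      \<open>r *\<^sub>R u\<close> of the solution.\<close>
    obtain \<rho> \<delta> where \<rho>: "0 < \<rho>" "\<rho> \<le> \<epsilon>/2" and \<delta>: "0 < \<delta>" and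
      fixp: "\<And>T. continuous_on (cball u\<^sub>0 \<rho>) T \<Longrightarrow>
        (\<And>u. u \<in> cball u\<^sub>0 \<rho> \<Longrightarrow> norm (T u - T\<^sub>0 u) \<le> \<delta>) \<Longrightarrow> \<exists>u\<in>cball u\<^sub>0 \<rho>. T u = 0"
      using perturbed_zero_exists[OF der zero surj, of "\<epsilon>/2"] \<epsilon> by (metis half_gt_zero)
    define M where "M = norm u\<^sub>0 + \<rho>"
    have M: "M > 0" using \<rho> by (simp add: M_def add_nonneg_pos)
    \<comment> \<open>The tolerance \<open>\<delta>\<close> is split into thirds: Taylor remainder,
      deviation of \<open>s\<close> from \<open>\<beta> * l\<close>, variation of \<open>Q\<close>.
      For the first, |y| is at most 2 M r, |s| at most (|\<beta>| + 1) r^2 and |l| = r^2, which adds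
      up to the factor in the denominator.\<close>
    define \<epsilon>\<^sub>1 where "\<epsilon>\<^sub>1 = \<delta> / (3 * (4 * M\<^sup>2 + \<bar>\<beta>\<bar> + 2))"
    have den: "4 * M\<^sup>2 + \<bar>\<beta>\<bar> + 2 > 0" using zero_le_power2[of M] by linarith
    have \<epsilon>1: "\<epsilon>\<^sub>1 > 0" "\<epsilon>\<^sub>1 * (4 * M\<^sup>2 + \<bar>\<beta>\<bar> + 2) = \<delta>/3"
    proof -
      have "x > 0 \<Longrightarrow> \<delta> / (3 * x) * x = \<delta> / 3" for x by simp
      then show "\<epsilon>\<^sub>1 * (4 * M\<^sup>2 + \<bar>\<beta>\<bar> + 2) = \<delta>/3" unfolding \<epsilon>\<^sub>1_def using den by blast
      show "\<epsilon>\<^sub>1 > 0" unfolding \<epsilon>\<^sub>1_def using \<delta> den by (intro divide_pos_pos mult_pos_pos) auto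
    qed
    obtain \<delta>\<^sub>1 where \<delta>1: "\<delta>\<^sub>1 > 0" and tay: "\<And>y s l. norm y \<le> \<delta>\<^sub>1 \<Longrightarrow> \<bar>s\<bar> \<le> \<delta>\<^sub>1 \<Longrightarrow> \<bar>l\<bar> \<le> \<delta>\<^sub>1 \<Longrightarrow>
      norm (G y s l - (J y + s *\<^sub>R k + (1/2) *\<^sub>R Q y)) \<le> \<epsilon>\<^sub>1 * ((norm y)\<^sup>2 + \<bar>s\<bar> + \<bar>l\<bar>)"
      using taylor[OF \<epsilon>1(1)] by blast
    \<comment> \<open>The ball contains both \<open>a u *\<^sub>R v\<close> and
      \<open>a u *\<^sub>R v + r *\<^sub>R u\<close>; the bound \<open>2*\<delta>/3\<close> becomes
      a third of \<open>\<delta>\<close> through the factor 1/2 in front of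
      \<open>Q\<close>.\<close>
    have "uniformly_continuous_on (cball 0 (2*M)) Q"
      using Qcont by (intro compact_uniformly_continuous) (auto intro: continuous_on_subset)
    then obtain \<eta> where \<eta>: "\<eta> > 0" and unif: "\<And>x y. x \<in> cball 0 (2*M) \<Longrightarrow> y \<in> cball 0 (2*M) \<Longrightarrow>
        dist y x < \<eta> \<Longrightarrow> dist (Q y) (Q x) < 2*\<delta>/3"
      unfolding uniformly_continuous_on_def using \<delta> by (metis divide_pos_pos mult_pos_pos zero_less_numeral)
    \<comment> \<open>A bound for sqrt |l|. The entries after 1 keep the arguments inside the Taylor
      range, keep \<open>r *\<^sub>R u\<close> below the modulus \<open>\<eta>\<close>, and make
      \<open>r * M\<close> at most \<open>\<epsilon>/2\<close>.\<close>
    define r\<^sub>1 where "r\<^sub>1 = Min {1, \<delta>\<^sub>1 / (2*M + \<bar>\<beta>\<bar> + 2), \<eta> / M, \<epsilon> / (2*M)}"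
    have r1: "0 < r\<^sub>1" "r\<^sub>1 \<le> 1" "r\<^sub>1 \<le> \<delta>\<^sub>1 / (2*M + \<bar>\<beta>\<bar> + 2)" "r\<^sub>1 \<le> \<eta> / M" "r\<^sub>1 \<le> \<epsilon> / (2*M)"
      using M \<delta>1 \<eta> \<epsilon> unfolding r\<^sub>1_def by (auto intro!: divide_pos_pos)
    \<comment> \<open>A bound for |l| itself, hence the square of \<open>r\<^sub>1\<close>. It also
      limits the relative deviation of \<open>s\<close> from \<open>\<beta> * l\<close>, so that its
      contribution along \<open>k\<close> stays below a third of \<open>\<delta>\<close>.\<close>
    define r\<^sub>0 where "r\<^sub>0 = Min {r\<^sub>1\<^sup>2, 1, \<delta> / (3 * (norm k + 1))}"
    have r0: "0 < r\<^sub>0" "r\<^sub>0 \<le> r\<^sub>1\<^sup>2" "r\<^sub>0 \<le> 1" "r\<^sub>0 \<le> \<delta> / (3 * (norm k + 1))"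
      using r1 \<delta> unfolding r\<^sub>0_def by (auto intro!: divide_pos_pos add_nonneg_pos)
    have r0k: "r\<^sub>0 * norm k \<le> \<delta> / 3"
    proof -
      have "r\<^sub>0 * norm k \<le> r\<^sub>0 * (norm k + 1)" using r0 by simp
      also have "\<dots> \<le> \<delta>/3"
      proof -
        have "norm k + 1 > 0" by (simp add: add_nonneg_pos)
        then show ?thesis using r0(4) by (simp add: field_simps)
      qed
      finally show ?thesis .
    qed
    have "\<exists>y. G y s l = 0 \<and> norm (y - (\<tau> * \<alpha> * sqrt \<bar>l\<bar>) *\<^sub>R v) \<le> \<epsilon> * sqrt \<bar>l\<bar>"
      if l: "0 < \<sigma> * l" "\<bar>l\<bar> < r\<^sub>0" and s: "\<bar>s - \<beta> * l\<bar> \<le> r\<^sub>0 * \<bar>l\<bar>" for l s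
    proof -
      define r where "r = sqrt \<bar>l\<bar>"
      have r: "r > 0" using l by (auto simp: r_def)
      have r2: "r\<^sup>2 = \<bar>l\<bar>" by (simp add: r_def)
      have ll: "l = \<sigma> * r\<^sup>2" using \<sigma> l by (auto simp: r2)
      have "r\<^sup>2 < r\<^sub>1\<^sup>2" using l r0 r2 by simp
      then have rr1: "r < r\<^sub>1" using r1(1) by (meson power2_less_imp_less less_imp_le)
      have rle1: "r \<le> 1" using rr1 r1 by simp
      have r2r: "r\<^sup>2 \<le> r" using rle1 r by (simp add: power2_eq_square mult_left_le)
      have rM: "r * M < \<eta>" "r * M \<le> \<epsilon>/2" "r * (2*M + \<bar>\<beta>\<bar> + 2) \<le> \<delta>\<^sub>1"
      proof -
        have "r < \<eta>/M" "r \<le> \<epsilon>/(2*M)" "r \<le> \<delta>\<^sub>1 / (2*M + \<bar>\<beta>\<bar> + 2)" using rr1 r1 by auto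
        moreover have "2*M + \<bar>\<beta>\<bar> + 2 > 0" using M by linarith
        ultimately show "r * M < \<eta>" "r * M \<le> \<epsilon>/2" "r * (2*M + \<bar>\<beta>\<bar> + 2) \<le> \<delta>\<^sub>1"
          using M by (auto simp: field_simps)
      qed
      have rparts: "r * (2*M) \<le> \<delta>\<^sub>1" "r * (\<bar>\<beta>\<bar> + 1) \<le> \<delta>\<^sub>1" "r \<le> \<delta>\<^sub>1"
      proof -
        have "r * (2*M) \<le> r * (2*M + \<bar>\<beta>\<bar> + 2)" "r * (\<bar>\<beta>\<bar> + 1) \<le> r * (2*M + \<bar>\<beta>\<bar> + 2)"
          "r * 1 \<le> r * (2*M + \<bar>\<beta>\<bar> + 2)" using r M by (auto intro!: mult_left_mono)
        then show "r * (2*M) \<le> \<delta>\<^sub>1" "r * (\<bar>\<beta>\<bar> + 1) \<le> \<delta>\<^sub>1" "r \<le> \<delta>\<^sub>1" using rM by auto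
      qed
      have sabs: "\<bar>s\<bar> \<le> (\<bar>\<beta>\<bar> + 1) * r\<^sup>2"
      proof -
        have "\<bar>s\<bar> \<le> \<bar>s - \<beta> * l\<bar> + \<bar>\<beta> * l\<bar>" by linarith
        also have "\<dots> \<le> 1 * \<bar>l\<bar> + \<bar>\<beta>\<bar> * \<bar>l\<bar>"
          using s r0(3) by (intro add_mono order_trans[OF s] mult_right_mono) (auto simp: abs_mult)
        finally show ?thesis by (simp add: r2 algebra_simps)
      qed
      define Y where "Y u = (r * a u) *\<^sub>R v + r\<^sup>2 *\<^sub>R u" for u
      define T where "T u = (1 / r\<^sup>2) *\<^sub>R G (Y u) s l" for u
      have "continuous_on UNIV (\<lambda>u. Y u)"
        unfolding Y_def a_def by (intro continuous_intros) (use vv in auto)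
      then have "continuous_on (cball u\<^sub>0 \<rho>) T"
        unfolding T_def
        by (intro continuous_intros continuous_on_compose2[OF cont]) (auto intro: continuous_on_subset)
      moreover have "norm (T u - T\<^sub>0 u) \<le> \<delta>" if u: "u \<in> cball u\<^sub>0 \<rho>" for u
      proof -
        have nu: "norm u \<le> M"
          using u norm_triangle_ineq2[of u u\<^sub>0] by (simp add: M_def dist_norm norm_minus_commute)
        have nav: "norm (a u *\<^sub>R v) \<le> M" using anorm[of u] nu by simp
        have ru: "norm (r *\<^sub>R u) \<le> r * M" using nu r by simp
        have ru': "norm (r *\<^sub>R u) \<le> M" 
          using order_trans[OF ru] mult_right_mono[OF rle1, of M] M by simp
        have Yr: "Y u = r *\<^sub>R (a u *\<^sub>R v + r *\<^sub>R u)"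
          by (simp add: Y_def scaleR_add_right power2_eq_square)
        have n2: "norm (a u *\<^sub>R v + r *\<^sub>R u) \<le> 2 * M"
          using norm_triangle_ineq[of "a u *\<^sub>R v" "r *\<^sub>R u"] nav ru' by linarith
        have nY: "norm (Y u) \<le> r * (2 * M)"
          unfolding Yr norm_scaleR using n2 r by (simp add: mult_left_mono)
        have "norm (G (Y u) s l - (J (Y u) + s *\<^sub>R k + (1/2) *\<^sub>R Q (Y u)))
            \<le> \<epsilon>\<^sub>1 * ((norm (Y u))\<^sup>2 + \<bar>s\<bar> + \<bar>l\<bar>)"
        proof (rule tay)
          show "norm (Y u) \<le> \<delta>\<^sub>1" using nY rparts by linarith
          have "(\<bar>\<beta>\<bar> + 1) * r\<^sup>2 \<le> (\<bar>\<beta>\<bar> + 1) * r" using r2r by (intro mult_left_mono) auto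
          then show "\<bar>s\<bar> \<le> \<delta>\<^sub>1" using sabs rparts by (simp add: mult.commute)
          show "\<bar>l\<bar> \<le> \<delta>\<^sub>1" using r2 r2r rparts by linarith
        qed
        also have "\<dots> \<le> \<epsilon>\<^sub>1 * ((4 * M\<^sup>2 + \<bar>\<beta>\<bar> + 2) * r\<^sup>2)"
        proof (intro mult_left_mono)
          have "(norm (Y u))\<^sup>2 \<le> (r * (2*M))\<^sup>2" using nY by (intro power_mono) auto
          then show "(norm (Y u))\<^sup>2 + \<bar>s\<bar> + \<bar>l\<bar> \<le> (4 * M\<^sup>2 + \<bar>\<beta>\<bar> + 2) * r\<^sup>2"
            using sabs r2 by (simp add: power_mult_distrib algebra_simps)
        qed (use \<epsilon>1 in simp)
        also have "\<dots> = \<delta>/3 * r\<^sup>2" by (simp only: mult.assoc[symmetric] \<epsilon>1(2))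
        finally have e1: "norm (G (Y u) s l - (J (Y u) + s *\<^sub>R k + (1/2) *\<^sub>R Q (Y u))) \<le> \<delta>/3 * r\<^sup>2" .
        define E where "E = G (Y u) s l - (J (Y u) + s *\<^sub>R k + (1/2) *\<^sub>R Q (Y u))"
        \<comment> \<open>The part of \<open>Y u\<close> of order \<open>r\<close> lies in the
          kernel of \<open>J\<close>, so the linear term has the same order \<open>r\<^sup>2\<close>
          as the others.\<close>
        have JY: "J (Y u) = r\<^sup>2 *\<^sub>R J u" 
          by (simp add: Y_def linear_add[OF J] linear_scale[OF J] Jv)
        have QY: "Q (Y u) = r\<^sup>2 *\<^sub>R Q (a u *\<^sub>R v + r *\<^sub>R u)" by (simp add: Yr Qhom)
        have Qa: "Q (a u *\<^sub>R v) = (a u)\<^sup>2 *\<^sub>R Q v" by (rule Qhom)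
        \<comment> \<open>The three summands are the three sources of error for which the thirds of
          \<open>\<delta>\<close> were reserved.\<close>
        have "T u - T\<^sub>0 u = (1/r\<^sup>2) *\<^sub>R E + ((s - \<beta> * l) / r\<^sup>2) *\<^sub>R k
            + (1/2) *\<^sub>R (Q (a u *\<^sub>R v + r *\<^sub>R u) - Q (a u *\<^sub>R v))"
        proof -
          have "T u = (1/r\<^sup>2) *\<^sub>R E + (1/r\<^sup>2) *\<^sub>R (J (Y u) + s *\<^sub>R k + (1/2) *\<^sub>R Q (Y u))"
            by (simp add: T_def E_def scaleR_add_right[symmetric])
          also have "(1/r\<^sup>2) *\<^sub>R (J (Y u) + s *\<^sub>R k + (1/2) *\<^sub>R Q (Y u)) =
              J u + (s / r\<^sup>2) *\<^sub>R k + (1/2) *\<^sub>R Q (a u *\<^sub>R v + r *\<^sub>R u)"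
            using r by (simp add: JY QY scaleR_add_right)
          finally have Tu: "T u = (1/r\<^sup>2) *\<^sub>R E + (J u + (s / r\<^sup>2) *\<^sub>R k + (1/2) *\<^sub>R Q (a u *\<^sub>R v + r *\<^sub>R u))" .
          have sk: "(s - \<beta> * l) / r\<^sup>2 = s / r\<^sup>2 - \<sigma> * \<beta>" using r by (simp add: ll field_simps)
          show ?thesis unfolding Tu T\<^sub>0_def Qa sk
            by (simp add: scaleR_diff_left scaleR_diff_right)
        qed
        also have "norm \<dots> \<le> norm ((1/r\<^sup>2) *\<^sub>R E) + norm (((s - \<beta> * l) / r\<^sup>2) *\<^sub>R k)
            + norm ((1/2) *\<^sub>R (Q (a u *\<^sub>R v + r *\<^sub>R u) - Q (a u *\<^sub>R v)))"
          by (intro order_trans[OF norm_triangle_ineq] add_mono order_refl norm_triangle_ineq)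
        also have "\<dots> \<le> \<delta>/3 + \<delta>/3 + \<delta>/3"
        proof (intro add_mono)
          show "norm ((1/r\<^sup>2) *\<^sub>R E) \<le> \<delta>/3"
            using e1 r unfolding E_def[symmetric] by (simp add: field_simps)
          have "\<bar>s - \<beta> * l\<bar> / r\<^sup>2 \<le> r\<^sub>0" using s r unfolding r2[symmetric] by (simp add: field_simps)
          then have "\<bar>s - \<beta> * l\<bar> / r\<^sup>2 * norm k \<le> r\<^sub>0 * norm k" by (intro mult_right_mono) auto
          then have "\<bar>s - \<beta> * l\<bar> / r\<^sup>2 * norm k \<le> \<delta>/3" using r0k by linarith
          then show "norm (((s - \<beta> * l) / r\<^sup>2) *\<^sub>R k) \<le> \<delta>/3" by (simp add: abs_divide)
          have "dist (Q (a u *\<^sub>R v + r *\<^sub>R u)) (Q (a u *\<^sub>R v)) < 2*\<delta>/3"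
          proof (rule unif)
            show "a u *\<^sub>R v \<in> cball 0 (2*M)" using nav M by simp
            show "a u *\<^sub>R v + r *\<^sub>R u \<in> cball 0 (2*M)" using n2 by simp
            show "dist (a u *\<^sub>R v + r *\<^sub>R u) (a u *\<^sub>R v) < \<eta>"
              unfolding dist_norm using ru rM(1) by simp
          qed
          then show "norm ((1/2) *\<^sub>R (Q (a u *\<^sub>R v + r *\<^sub>R u) - Q (a u *\<^sub>R v))) \<le> \<delta>/3"
            by (simp add: dist_norm)
        qed
        finally show ?thesis by simp
      qed
      ultimately obtain u where u: "u \<in> cball u\<^sub>0 \<rho>" "T u = 0" using fixp by blast
      have "G (Y u) s l = 0" using u(2) r by (simp add: T_def)
      moreover have "norm (Y u - (\<tau> * \<alpha> * sqrt \<bar>l\<bar>) *\<^sub>R v) \<le> \<epsilon> * sqrt \<bar>l\<bar>"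
      proof -
        have nu0: "norm (u - u\<^sub>0) \<le> \<rho>" using u(1) by (simp add: dist_norm norm_minus_commute)
        have nu: "norm u \<le> M"
          using nu0 norm_triangle_ineq2[of u u\<^sub>0] by (simp add: M_def)
        have "Y u - (\<tau> * \<alpha> * sqrt \<bar>l\<bar>) *\<^sub>R v = r *\<^sub>R (a (u - u\<^sub>0) *\<^sub>R v + r *\<^sub>R u)"
          by (simp add: Y_def r_def[symmetric] alin au0 algebra_simps power2_eq_square)
        then have "norm (Y u - (\<tau> * \<alpha> * sqrt \<bar>l\<bar>) *\<^sub>R v) = r * norm (a (u - u\<^sub>0) *\<^sub>R v + r *\<^sub>R u)"
          using r by simp
        also have "\<dots> \<le> r * (\<rho> + r * M)"
        proof (intro mult_left_mono order_trans[OF norm_triangle_ineq] add_mono)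
          show "norm (a (u - u\<^sub>0) *\<^sub>R v) \<le> \<rho>" using anorm[of "u - u\<^sub>0"] nu0 by simp
          show "norm (r *\<^sub>R u) \<le> r * M" using nu r by simp
        qed (use r in simp)
        also have "\<dots> \<le> r * \<epsilon>" using \<rho> rM r by (intro mult_left_mono) auto
        finally show ?thesis by (simp add: r_def mult.commute)
      qed
      ultimately show ?thesis by blast
    qed
    then show ?thesis using r0(1) by blast
  qed
  then show thesis using that \<sigma> \<alpha>(1) by blast
qed

section \<open>Calculus of k times continuously differentiable functions\<close>

lemma continuously_differentiable_const: "continuously_differentiable k (\<lambda>_. a)"
  by (induction k arbitrary: a) (auto simp: frechet_derivative_const)

lemma continuously_differentiable_add:
  "continuously_differentiable k f \<Longrightarrow> continuously_differentiable k g \<Longrightarrow>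
    continuously_differentiable k (\<lambda>x. f x + g x)"
proof (induction k arbitrary: f g)
  case (Suc k)
  have d: "f differentiable at x" "g differentiable at x" for x
    using Suc.prems by (auto simp: differentiable_on_eq_differentiable_at)
  have "frechet_derivative (\<lambda>x. f x + g x) (at x) =
      (\<lambda>e. frechet_derivative f (at x) e + frechet_derivative g (at x) e)" for x
    using has_derivative_add[OF d(1)[of x, unfolded frechet_derivative_works] d(2)[of x, unfolded frechet_derivative_works]]
    by (simp add: frechet_derivative_at[symmetric])
  then show ?case using Suc by (auto intro!: differentiable_on_add)
qed (auto intro: continuous_intros)

lemma continuously_differentiable_cmult:
  "continuously_differentiable k f \<Longrightarrow> continuously_differentiable k (\<lambda>x. a * f x)"
proof (induction k arbitrary: f)
  case (Suc k)
  have d: "f differentiable at x" for x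
    using Suc.prems by (auto simp: differentiable_on_eq_differentiable_at)
  have "frechet_derivative (\<lambda>x. a * f x) (at x) = (\<lambda>e. a * frechet_derivative f (at x) e)" for x
    using has_derivative_mult_right[OF d[of x, unfolded frechet_derivative_works], of a]
    by (simp add: frechet_derivative_at[symmetric])
  then show ?case using Suc by (auto intro!: differentiable_on_mult)
qed (auto intro: continuous_intros)

lemma continuously_differentiable_sum:
  "(\<And>i. i \<in> I \<Longrightarrow> continuously_differentiable k (f i)) \<Longrightarrow>
    continuously_differentiable k (\<lambda>x. \<Sum>i\<in>I. f i x)"
  by (induction I rule: infinite_finite_induct)
    (auto intro: continuously_differentiable_const continuously_differentiable_add)

lemma frechet_derivative_basis_expansion:
  fixes f :: "'a::euclidean_space \<Rightarrow> real"
  assumes "f differentiable at x"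
  shows "frechet_derivative f (at x) e = (\<Sum>b\<in>Basis. (e \<bullet> b) * frechet_derivative f (at x) b)"
proof -
  have lin: "linear (frechet_derivative f (at x))" using assms by (rule linear_frechet_derivative)
  have "frechet_derivative f (at x) e = frechet_derivative f (at x) (\<Sum>b\<in>Basis. (e \<bullet> b) *\<^sub>R b)"
    by (simp add: euclidean_representation)
  also have "\<dots> = (\<Sum>b\<in>Basis. (e \<bullet> b) * frechet_derivative f (at x) b)"
    by (simp add: linear_sum[OF lin] linear_scale[OF lin])
  finally show ?thesis .
qed

lemma frechet_derivative_compose_linear:
  assumes "f differentiable at (L x)" "linear (L :: 'a::euclidean_space \<Rightarrow> 'b::euclidean_space)"
  shows "((\<lambda>x. f (L x)) has_derivative (\<lambda>e. frechet_derivative f (at (L x)) (L e))) (at x)"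
proof -
  have "(L has_derivative L) (at x)"
    using assms(2) linear_conv_bounded_linear linear_imp_has_derivative by blast
  from has_derivative_compose[OF this assms(1)[unfolded frechet_derivative_works]]
  show ?thesis .
qed

text \<open>The inner direction \<open>L e\<close> need not be a basis vector. Expanding it in the
  basis writes the derivative of the composite as a combination of partial derivatives of
  \<open>f\<close> composed with \<open>L\<close>, to which the induction hypothesis
  applies.\<close>

lemma continuously_differentiable_compose_linear:
  fixes f :: "'b::euclidean_space \<Rightarrow> real" and L :: "'a::euclidean_space \<Rightarrow> 'b"
  assumes L: "linear L"
  shows "continuously_differentiable k f \<Longrightarrow> continuously_differentiable k (\<lambda>x. f (L x))"
proof (induction k arbitrary: f)
  case 0
  then show ?case
    using linear_continuous_on[of L UNIV] L
    by (auto intro: continuous_on_compose2[where g=f and t=UNIV] simp: linear_conv_bounded_linear)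
next
  case (Suc k)
  have d: "f differentiable at x" for x
    using Suc.prems by (auto simp: differentiable_on_eq_differentiable_at)
  note der = frechet_derivative_compose_linear[OF d L]
  have "frechet_derivative (\<lambda>x. f (L x)) (at x) e =
      (\<Sum>b\<in>Basis. (L e \<bullet> b) * frechet_derivative f (at (L x)) b)" for x e
    using frechet_derivative_at[OF der[of x]] frechet_derivative_basis_expansion[OF d] by metis
  moreover have "(\<lambda>x. f (L x)) differentiable_on UNIV"
    using der by (auto simp: differentiable_on_eq_differentiable_at differentiable_def)
  ultimately show ?case
    using Suc by (auto intro!: continuously_differentiable_sum continuously_differentiable_cmult)
qed

text \<open>The definition speaks of basis directions only; an arbitrary direction is a constant
  linear combination of them.\<close>

lemma continuously_differentiable_derivative:
  fixes f :: "'a::euclidean_space \<Rightarrow> real"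
  assumes "continuously_differentiable (Suc k) f"
  shows "continuously_differentiable k (\<lambda>x. frechet_derivative f (at x) e)"
proof -
  have d: "f differentiable at x" for x
    using assms by (auto simp: differentiable_on_eq_differentiable_at)
  then have "(\<lambda>x. frechet_derivative f (at x) e) =
      (\<lambda>x. \<Sum>b\<in>Basis. (e \<bullet> b) * frechet_derivative f (at x) b)"
    using frechet_derivative_basis_expansion by blast
  then show ?thesis
    using assms by (auto intro!: continuously_differentiable_sum continuously_differentiable_cmult)
qed

lemma continuously_differentiable_imp_differentiable:
  "continuously_differentiable (Suc k) f \<Longrightarrow> f differentiable at x"
  by (auto simp: differentiable_on_eq_differentiable_at)

definition second_derivative :: "('a::euclidean_space \<Rightarrow> real) \<Rightarrow> 'a \<Rightarrow> 'a \<Rightarrow> real" where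
  "second_derivative f p q = frechet_derivative (\<lambda>x. frechet_derivative f (at x) p) (at 0) q"

text \<open>Linearity in the first argument holds because the first derivative is linear in its
  direction at every point and differentiation respects linear combinations; in the second argument
  it is linearity of a derivative.\<close>

lemma bilinear_second_derivative:
  assumes "continuously_differentiable (Suc (Suc k)) f"
  shows "bilinear (second_derivative f)"
proof -
  have d: "f differentiable at x" for x
    by (rule continuously_differentiable_imp_differentiable[OF assms])
  have d2: "(\<lambda>x. frechet_derivative f (at x) p) differentiable at x" for p x
    by (rule continuously_differentiable_imp_differentiable[OF continuously_differentiable_derivative[OF assms]])
  note h2 = d2[unfolded frechet_derivative_works]
  note l1 = linear_frechet_derivative[OF d]
  have "frechet_derivative (\<lambda>x. frechet_derivative f (at x) (p + q)) (at 0) =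
      (\<lambda>e. second_derivative f p e + second_derivative f q e)" for p q
    unfolding linear_add[OF l1] second_derivative_def
    by (rule frechet_derivative_at[OF has_derivative_add[OF h2 h2], symmetric])
  moreover have "frechet_derivative (\<lambda>x. frechet_derivative f (at x) (a *\<^sub>R p)) (at 0) =
      (\<lambda>e. a *\<^sub>R second_derivative f p e)" for a p
    unfolding linear_scale[OF l1] second_derivative_def
    by (rule frechet_derivative_at[OF has_derivative_scaleR_right[OF h2], symmetric])
  ultimately have "linear (\<lambda>p. second_derivative f p e)" for e
    by (intro linearI) (simp_all add: second_derivative_def)
  moreover have "linear (second_derivative f p)" for p
    unfolding second_derivative_def[abs_def] by (rule linear_frechet_derivative[OF d2])
  ultimately show ?thesis unfolding bilinear_def by blast
qed

section \<open>Taylor expansion at the origin\<close>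

text \<open>Differentiability of the partial derivatives at 0 gives a first order expansion of the
  derivative, uniform in the direction because the basis is finite. The mean value theorem along the
  segment from 0 to \<open>p\<close> transfers it to \<open>f\<close>.\<close>

lemma taylor_second_order:
  fixes f :: "'a::euclidean_space \<Rightarrow> real"
  assumes f: "continuously_differentiable (Suc (Suc k)) f" and \<epsilon>: "\<epsilon> > 0"
  obtains \<delta> where "\<delta> > 0" "\<And>p. norm p < \<delta> \<Longrightarrow>
    \<bar>f p - f 0 - frechet_derivative f (at 0) p - second_derivative f p p / 2\<bar> \<le> \<epsilon> * (norm p)\<^sup>2"
proof -
  define D where "D x e = frechet_derivative f (at x) e" for x e
  define N where "N = real DIM('a)"
  have N: "N > 0" by (simp add: N_def)
  have d: "f differentiable at x" for x
    by (rule continuously_differentiable_imp_differentiable[OF f])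
  have Dh: "(f has_derivative D x) (at x)" for x
    using d[of x] unfolding frechet_derivative_works D_def[abs_def] .
  \<comment> \<open>Dividing by the dimension \<open>N\<close> pays for the later sum over the
    basis.\<close>
  have "\<exists>\<delta>>0. \<forall>x. norm x < \<delta> \<longrightarrow> \<bar>D x b - D 0 b - second_derivative f b x\<bar> \<le> \<epsilon> / N * norm x" for b
  proof -
    have "((\<lambda>x. D x b) has_derivative second_derivative f b) (at 0)"
      using continuously_differentiable_imp_differentiable[OF continuously_differentiable_derivative[OF f]]
      unfolding frechet_derivative_works second_derivative_def[abs_def] D_def by blast
    then show ?thesis using \<epsilon> N unfolding has_derivative_at_alt
      by (metis diff_zero divide_pos_pos real_norm_def)
  qed
  then obtain d\<^sub>b where db: "\<And>b. d\<^sub>b b > 0" "\<And>b x. norm x < d\<^sub>b b \<Longrightarrow>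
      \<bar>D x b - D 0 b - second_derivative f b x\<bar> \<le> \<epsilon> / N * norm x" by metis
  define \<delta> where "\<delta> = Min (d\<^sub>b ` (Basis :: 'a set))"
  have \<delta>: "\<delta> > 0" "\<And>b. b \<in> Basis \<Longrightarrow> \<delta> \<le> d\<^sub>b b" using db by (auto simp: \<delta>_def)
  note bil = bilinear_second_derivative[OF f]
  have unif: "\<bar>D x e - D 0 e - second_derivative f e x\<bar> \<le> \<epsilon> * norm x * norm e"
    if x: "norm x < \<delta>" for x e
  proof -
    have "second_derivative f e x = second_derivative f (\<Sum>b\<in>Basis. (e \<bullet> b) *\<^sub>R b) x"
      by (simp add: euclidean_representation)
    also have "\<dots> = (\<Sum>b\<in>Basis. (e \<bullet> b) * second_derivative f b x)"
      using bil unfolding bilinear_def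
      by (simp add: linear_sum[where f="\<lambda>y. second_derivative f y x"]
          linear_scale[where f="\<lambda>y. second_derivative f y x"])
    finally have "D x e - D 0 e - second_derivative f e x =
        (\<Sum>b\<in>Basis. (e \<bullet> b) * (D x b - D 0 b - second_derivative f b x))"
      unfolding D_def using frechet_derivative_basis_expansion[OF d, of _ e]
      by (simp add: sum_subtractf right_diff_distrib)
    also have "\<bar>\<dots>\<bar> \<le> (\<Sum>b\<in>(Basis::'a set). norm e * (\<epsilon> / N * norm x))"
    proof (rule order_trans[OF sum_abs], rule sum_mono)
      fix b :: 'a assume b: "b \<in> Basis"
      have "\<bar>D x b - D 0 b - second_derivative f b x\<bar> \<le> \<epsilon> / N * norm x"
        using db(2) \<delta>(2)[OF b] x by simp
      then show "\<bar>(e \<bullet> b) * (D x b - D 0 b - second_derivative f b x)\<bar> \<le> norm e * (\<epsilon> / N * norm x)"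
        unfolding abs_mult using Basis_le_norm[OF b, of e] by (intro mult_mono) auto
    qed
    also have "\<dots> = \<epsilon> * norm x * norm e" using N by (simp add: N_def)
    finally show ?thesis .
  qed
  have "\<bar>f p - f 0 - D 0 p - second_derivative f p p / 2\<bar> \<le> \<epsilon> * (norm p)\<^sup>2" if p: "norm p < \<delta>" for p
  proof -
    \<comment> \<open>\<open>q\<close> is, up to the constant \<open>f 0\<close>, the Taylor
      remainder along the segment; its derivative \<open>q' t 1\<close> is the error bounded by
      \<open>unif\<close> at \<open>t *\<^sub>R p\<close> in the direction \<open>p\<close>.\<close>
    define q where "q t = f (t *\<^sub>R p) - t * D 0 p - t\<^sup>2 * second_derivative f p p / 2" for t :: real
    define q' where "q' t h = D (t *\<^sub>R p) (h *\<^sub>R p) - h * D 0 p - h * t * second_derivative f p p" for t h :: real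
    have qder: "(q has_derivative q' t) (at t)" for t
    proof -
      have "((\<lambda>t. f (t *\<^sub>R p)) has_derivative (\<lambda>h. D (t *\<^sub>R p) (h *\<^sub>R p))) (at t)"
        by (rule has_derivative_compose[where g = f and f = "\<lambda>t. t *\<^sub>R p", OF _ Dh]) (auto intro!: derivative_eq_intros)
      then show ?thesis unfolding q_def[abs_def] q'_def[abs_def]
        by (auto intro!: derivative_eq_intros simp: fun_eq_iff)
    qed
    have "continuous_on {0..1} q"
      using qder by (meson has_derivative_continuous_on has_derivative_at_withinI)
    then obtain t where t: "t \<in> {0<..<1}" "norm (q 1 - q 0) \<le> norm (q' t (1 - 0))"
      using mvt_general[of 0 1 q q'] qder by auto
    have tp: "norm (t *\<^sub>R p) < \<delta>" "norm (t *\<^sub>R p) \<le> norm p"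
    proof -
      show "norm (t *\<^sub>R p) \<le> norm p" using t(1) by (simp add: mult_left_le_one_le)
      then show "norm (t *\<^sub>R p) < \<delta>" using p by simp
    qed
    have "second_derivative f p (t *\<^sub>R p) = t * second_derivative f p p"
      using bilinear_rmul[OF bil, of p t p] by simp
    then have "\<bar>q' t 1\<bar> \<le> \<epsilon> * norm (t *\<^sub>R p) * norm p"
      using unif[OF tp(1), of p] by (simp add: q'_def)
    also have "\<dots> \<le> \<epsilon> * norm p * norm p" using tp(2) \<epsilon> by (intro mult_right_mono mult_left_mono) auto
    finally have "\<bar>q' t 1\<bar> \<le> \<epsilon> * (norm p)\<^sup>2" by (simp add: power2_eq_square mult.assoc)
    moreover have "q 1 - q 0 = f p - f 0 - D 0 p - second_derivative f p p / 2" by (simp add: q_def)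
    ultimately show ?thesis using t(2) by simp
  qed
  then show thesis using that \<delta>(1) unfolding D_def by blast
qed

text \<open>An expansion to second order in \<open>p\<close> and first order in \<open>q\<close>:
  every quadratic term containing \<open>q\<close> is a small multiple of \<open>norm q\<close>,
  since its other factor is small. It will be used with the downstream state as \<open>p\<close> and
  the pair of the state of c and the parameter as \<open>q\<close>.\<close>

lemma taylor_mixed_order:
  fixes f :: "'a::euclidean_space \<Rightarrow> real"
  assumes f: "continuously_differentiable (Suc (Suc k)) f" and f0: "f 0 = 0" and \<epsilon>: "\<epsilon> > 0"
  obtains \<delta> where "\<delta> > 0" "\<And>p q. norm p \<le> \<delta> \<Longrightarrow> norm q \<le> \<delta> \<Longrightarrow>
    \<bar>f (p + q) - (frechet_derivative f (at 0) p + frechet_derivative f (at 0) q + second_derivative f p p / 2)\<bar>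
      \<le> \<epsilon> * ((norm p)\<^sup>2 + norm q)"
proof -
  note bil = bilinear_second_derivative[OF f]
  obtain B where B: "B > 0" "\<And>x y. norm (second_derivative f x y) \<le> B * norm x * norm y"
    using bilinear_bounded_pos[OF bil] by blast
  obtain \<delta>\<^sub>1 where \<delta>1: "\<delta>\<^sub>1 > 0" and t: "\<And>p. norm p < \<delta>\<^sub>1 \<Longrightarrow>
    \<bar>f p - f 0 - frechet_derivative f (at 0) p - second_derivative f p p / 2\<bar> \<le> \<epsilon>/2 * (norm p)\<^sup>2"
    using taylor_second_order[OF f, of "\<epsilon>/2"] \<epsilon> by auto
  \<comment> \<open>\<open>\<delta>\<^sub>1/3\<close> keeps \<open>p + q\<close> inside the Taylor
    radius, 1/6 makes 2 |p| + |q| at most 1, and the last entry bounds each quadratic term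
    containing \<open>q\<close> by \<open>\<epsilon>/4 * norm q\<close>.\<close>
  define \<delta> where "\<delta> = Min {\<delta>\<^sub>1/3, 1/6, \<epsilon> / (4 * B)}"
  have \<delta>: "\<delta> > 0" "\<delta> \<le> \<delta>\<^sub>1/3" "\<delta> \<le> 1/6" "\<delta> \<le> \<epsilon> / (4 * B)" using \<delta>1 \<epsilon> B by (auto simp: \<delta>_def)
  have B\<delta>: "B * \<delta> \<le> \<epsilon> / 4" using \<delta>(4) B(1) by (simp add: field_simps)
  have lin: "linear (frechet_derivative f (at 0))"
    by (rule linear_frechet_derivative[OF continuously_differentiable_imp_differentiable[OF f]])
  have "\<bar>f (p + q) - (frechet_derivative f (at 0) p + frechet_derivative f (at 0) q + second_derivative f p p / 2)\<bar>
      \<le> \<epsilon> * ((norm p)\<^sup>2 + norm q)" if p: "norm p \<le> \<delta>" and q: "norm q \<le> \<delta>" for p q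
  proof -
    have npq: "norm (p + q) \<le> norm p + norm q" by (rule norm_triangle_ineq)
    have "\<bar>f (p + q) - f 0 - frechet_derivative f (at 0) (p + q) - second_derivative f (p + q) (p + q) / 2\<bar>
        \<le> \<epsilon>/2 * (norm (p + q))\<^sup>2"
      using npq p q \<delta> by (intro t) linarith
    also have "\<dots> \<le> \<epsilon>/2 * ((norm p)\<^sup>2 + norm q)"
    proof (intro mult_left_mono)
      have "(norm (p + q))\<^sup>2 \<le> (norm p + norm q)\<^sup>2" using npq by (intro power_mono) auto
      also have "\<dots> = (norm p)\<^sup>2 + norm q * (2 * norm p + norm q)"
        by (simp add: power2_eq_square algebra_simps)
      also have "\<dots> \<le> (norm p)\<^sup>2 + norm q * 1"
        using p q \<delta>(3) by (intro add_left_mono mult_left_mono) auto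
      finally show "(norm (p + q))\<^sup>2 \<le> (norm p)\<^sup>2 + norm q" by simp
    qed (use \<epsilon> in simp)
    finally have 1: "\<bar>f (p + q) - f 0 - frechet_derivative f (at 0) (p + q)
      - second_derivative f (p + q) (p + q) / 2\<bar> \<le> \<epsilon>/2 * ((norm p)\<^sup>2 + norm q)" .
    have cr: "norm (second_derivative f x y) \<le> \<epsilon>/4 * norm z"
      if "x = z \<and> norm y \<le> \<delta> \<or> y = z \<and> norm x \<le> \<delta>" for x y z
    proof -
      have "norm x * norm y \<le> \<delta> * norm z"
        using that mult_left_mono[of "norm y" \<delta> "norm x"] mult_right_mono[of "norm x" \<delta> "norm y"]
        by (auto simp: mult.commute)
      then have "B * norm x * norm y \<le> B * \<delta> * norm z"
        using B(1) by (simp add: mult.assoc)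
      then have "norm (second_derivative f x y) \<le> B * \<delta> * norm z"
        using B(2) order_trans by blast
      also have "\<dots> \<le> \<epsilon>/4 * norm z" using B\<delta> by (intro mult_right_mono) auto
      finally show ?thesis .
    qed
    have 2: "second_derivative f (p + q) (p + q) = second_derivative f p p + second_derivative f p q
        + second_derivative f q p + second_derivative f q q"
      by (simp add: bilinear_ladd[OF bil] bilinear_radd[OF bil])
    have "\<bar>second_derivative f p q\<bar> \<le> \<epsilon>/4 * norm q" "\<bar>second_derivative f q p\<bar> \<le> \<epsilon>/4 * norm q"
      "\<bar>second_derivative f q q\<bar> \<le> \<epsilon>/4 * norm q"
      using cr[of p q q] cr[of q q p] cr[of q q q] p q by auto
    then have "\<bar>second_derivative f (p + q) (p + q) / 2 - second_derivative f p p / 2\<bar> \<le> \<epsilon>/2 * norm q"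
      unfolding 2 using mult_nonneg_nonneg[OF less_imp_le[OF \<epsilon>] norm_ge_zero[of q]]
      by (simp add: abs_le_iff field_simps) linarith
    then have "\<bar>f (p + q) - (frechet_derivative f (at 0) p + frechet_derivative f (at 0) q + second_derivative f p p / 2)\<bar>
        \<le> \<epsilon>/2 * ((norm p)\<^sup>2 + norm q) + \<epsilon>/2 * norm q"
      using 1 unfolding linear_add[OF lin] f0 by linarith
    also have "\<dots> \<le> \<epsilon> * ((norm p)\<^sup>2 + norm q)" using \<epsilon> by (simp add: algebra_simps)
    finally show ?thesis .
  qed
  then show thesis using that \<delta>(1) by blast
qed

section \<open>Splitting the coalescence into an upstream and a downstream system\<close>

lemma sum_UNIV_option:
  fixes f :: "'q::finite option \<Rightarrow> 'b::comm_monoid_add"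
  shows "(\<Sum>i\<in>UNIV. f i) = f None + (\<Sum>e\<in>UNIV. f (Some e))"
  by (simp add: UNIV_option_conv sum.reindex)

lemma sum_UNIV_sum_type:
  fixes f :: "'p::finite + 'q::finite \<Rightarrow> 'b::comm_monoid_add"
  shows "(\<Sum>i\<in>UNIV. f i) = (\<Sum>i\<in>UNIV. f (Inl i)) + (\<Sum>e\<in>UNIV. f (Inr e))"
  by (simp add: UNIV_Plus_UNIV[symmetric] sum.Plus del: UNIV_Plus_UNIV)

definition embed :: "real^'q::finite \<Rightarrow> real \<Rightarrow> real^('q option)" where
  "embed y s = (\<chi> i. case i of None \<Rightarrow> s | Some e \<Rightarrow> y $ e)"

lemma embed_nth [simp]: "embed y s $ None = s" "embed y s $ Some e = y $ e"
  by (simp_all add: embed_def)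

lemma embed_eq_add: "embed y s = embed y 0 + s *\<^sub>R axis None 1"
  by (simp add: vec_eq_iff embed_def axis_def split: option.split)

lemma embed_0_eq_sum: "embed y 0 = (\<Sum>e\<in>UNIV. y $ e *\<^sub>R axis (Some e) 1)"
proof -
  have "embed y 0 $ i = (\<Sum>e\<in>UNIV. y $ e *\<^sub>R axis (Some e) 1) $ i" for i
    by (cases i) (simp_all add: sum_component axis_def if_distrib if_distribR cong: if_cong)
  then show ?thesis by (simp add: vec_eq_iff)
qed

lemma norm_embed_0: "norm (embed y 0) = norm y"
  by (simp add: norm_eq_sqrt_inner inner_vec_def sum_UNIV_option)

lemma linear_embed_0: "linear (\<lambda>y. embed y 0)"
  by (rule linearI) (auto simp: vec_eq_iff embed_def split: option.split)

text \<open>The map G of the overview. The state \<open>s\<close> of the coalescence cell and the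
  parameter \<open>l\<close> are independent arguments, so that the value of a branch of the first
  network can be inserted pointwise.\<close>

definition downstream ::
    "(real \<times> real \<Rightarrow> real) \<Rightarrow> (real \<times> real \<times> real \<Rightarrow> real) \<Rightarrow>
     real^('q::finite option)^('q option) \<Rightarrow> real^'q \<Rightarrow> real \<Rightarrow> real \<Rightarrow> real^'q" where
  "downstream g h W y s l = (\<chi> d. admissible g h W (embed y s) l $ Some d)"

text \<open>Feedforward removes all inputs from downstream cells to c. The self-loop that c inherits
  from the second network multiplies \<open>h\<close> on the diagonal, which is 0 by diffusivity. So
  the first network evolves on its own.\<close>

lemma admissible_coalescence:
  assumes "feedforward W2" and "diffusive h"
  shows "admissible g h (coalescence c W1 W2) (join x y) l =
    join (admissible g h W1 x l) (downstream g h W2 y (x $ c) l)"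
proof -
  have "admissible g h (coalescence c W1 W2) (join x y) l $ a =
    join (admissible g h W1 x l) (downstream g h W2 y (x $ c) l) $ a" for a
  proof (cases a)
    case (Inl i)
    have "h (x $ i, x $ i, l) = 0" using assms(2) by (simp add: diffusive_def)
    then have "(W1 $ i $ j + (if i = c \<and> j = c then W2 $ None $ None else 0)) * h (x $ i, x $ j, l)
        = W1 $ i $ j * h (x $ i, x $ j, l)" for j by auto
    then have "(\<Sum>j\<in>UNIV. (W1 $ i $ j + (if i = c \<and> j = c then W2 $ None $ None else 0)) * h (x $ i, x $ j, l))
        = (\<Sum>j\<in>UNIV. W1 $ i $ j * h (x $ i, x $ j, l))" by (intro sum.cong refl)
    then show ?thesis
      using assms(1)
      by (simp add: Inl admissible_def coalescence_def join_def sum_UNIV_sum_type feedforward_def cong: if_cong)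
  next
    case (Inr d)
    then show ?thesis
      by (simp add: admissible_def coalescence_def join_def downstream_def sum_UNIV_sum_type sum_UNIV_option
          if_distrib[of "\<lambda>z. z * _"] cong: if_cong)
  qed
  then show ?thesis by (simp add: vec_eq_iff)
qed

section \<open>Derivatives of admissible systems at the origin\<close>

lemma frechet_derivative_zero_along:
  fixes f :: "'a::euclidean_space \<Rightarrow> real"
  assumes "f differentiable at 0" and "\<And>t. f (t *\<^sub>R e) = 0"
  shows "frechet_derivative f (at 0) e = 0"
proof -
  have "((\<lambda>t. f (t *\<^sub>R e)) has_derivative (\<lambda>t. frechet_derivative f (at (0 *\<^sub>R e)) (t *\<^sub>R e))) (at 0)"
    using assms(1) by (intro frechet_derivative_compose_linear) (auto intro!: linearI simp: scaleR_add_left)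
  then have "((\<lambda>t::real. 0) has_derivative (\<lambda>t. frechet_derivative f (at 0) (t *\<^sub>R e))) (at 0)"
    using assms(2) by simp
  then have "(\<lambda>t. frechet_derivative f (at 0) (t *\<^sub>R e)) = (\<lambda>t. 0)"
    by (metis has_derivative_const has_derivative_unique)
  from fun_cong[OF this, of 1] show ?thesis by simp
qed

lemma deriv_eq_frechet_derivative:
  fixes f :: "'a::euclidean_space \<Rightarrow> real"
  assumes "f differentiable at 0"
  shows "deriv (\<lambda>t. f (t *\<^sub>R e)) 0 = frechet_derivative f (at 0) e"
proof -
  have "((\<lambda>t. f (t *\<^sub>R e)) has_derivative (\<lambda>t. frechet_derivative f (at (0 *\<^sub>R e)) (t *\<^sub>R e))) (at 0)"
    using assms(1) by (intro frechet_derivative_compose_linear) (auto intro!: linearI simp: scaleR_add_left)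
  then have "((\<lambda>t. f (t *\<^sub>R e)) has_real_derivative frechet_derivative f (at 0) e) (at 0)"
    unfolding has_field_derivative_def
    by (simp add: linear_scale[OF linear_frechet_derivative[OF assms]] mult.commute[of _ "frechet_derivative f (at 0) e"])
  then show ?thesis by (rule DERIV_imp_deriv)
qed

lemma smooth_imp_differentiable: "smooth f \<Longrightarrow> f differentiable at x"
  unfolding smooth_def using continuously_differentiable_imp_differentiable by blast

lemma linear_cell_arguments:
  "linear (\<lambda>p::(real^'n) \<times> real. (fst p $ i, snd p))"
  "linear (\<lambda>p::(real^'n) \<times> real. (fst p $ i, fst p $ j, snd p))"
  by (auto intro!: linearI)

lemma continuously_differentiable_admissible:
  assumes "smooth g" and "smooth h"
  shows "continuously_differentiable k (\<lambda>p. admissible g h W (fst p) (snd p) $ i)"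
proof -
  have "continuously_differentiable k g" "continuously_differentiable k h"
    using assms by (auto simp: smooth_def)
  then show ?thesis
    unfolding admissible_def vec_lambda_beta
    by (intro continuously_differentiable_add continuously_differentiable_sum continuously_differentiable_cmult
      continuously_differentiable_compose_linear[OF linear_cell_arguments(1), where f = g]
      continuously_differentiable_compose_linear[OF linear_cell_arguments(2), where f = h])
qed

text \<open>The parameter direction drops out because \<open>g\<close> and \<open>h\<close> vanish
  at the origin for all parameters. As \<open>h\<close> vanishes on the diagonal, its two state
  derivatives are opposite, which produces the differences; their weighted sum is the Laplacian
  applied to \<open>x\<close>.\<close>

lemma frechet_derivative_admissible_origin:
  fixes W :: "real^'n^'n"
  assumes g: "smooth g" and h: "smooth h" and diff: "diffusive h" and g0: "\<And>l. g (0, l) = 0"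
  shows "frechet_derivative (\<lambda>p. admissible g h W (fst p) (snd p) $ i) (at 0) (x, l) =
    deriv (\<lambda>x. g (x, 0)) 0 * x $ i + deriv (\<lambda>x. h (x, 0, 0)) 0 * (\<Sum>j\<in>UNIV. W $ i $ j * (x $ i - x $ j))"
proof -
  let ?Dg = "frechet_derivative g (at 0)" and ?Dh = "frechet_derivative h (at 0)"
  note dg = smooth_imp_differentiable[OF g] and dh = smooth_imp_differentiable[OF h]
  note lg = linear_frechet_derivative[OF dg, of 0] and lh = linear_frechet_derivative[OF dh, of 0]
  have Dg: "?Dg (a, l) = deriv (\<lambda>x. g (x, 0)) 0 * a" for a
  proof -
    have "?Dg (0, 1) = 0" using g0 by (intro frechet_derivative_zero_along dg) simp
    moreover have "?Dg (1, 0) = deriv (\<lambda>x. g (x, 0)) 0"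
      using deriv_eq_frechet_derivative[OF dg, of "(1, 0)"] by simp
    moreover have "(a, l) = a *\<^sub>R (1, 0) + l *\<^sub>R (0, 1)" by simp
    ultimately show ?thesis by (simp only: linear_add[OF lg] linear_scale[OF lg]) simp
  qed
  have Dh: "?Dh (a, b, l) = deriv (\<lambda>x. h (x, 0, 0)) 0 * (a - b)" for a b
  proof -
    have "?Dh (1, 1, 0) = 0" "?Dh (0, 0, 1) = 0"
      using diff by (auto intro!: frechet_derivative_zero_along dh simp: diffusive_def)
    moreover have "?Dh (1, 0, 0) = deriv (\<lambda>x. h (x, 0, 0)) 0"
      using deriv_eq_frechet_derivative[OF dh, of "(1, 0, 0)"] by simp
    moreover have "(a, b, l) = (a - b) *\<^sub>R (1, 0, 0) + b *\<^sub>R (1, 1, 0) + l *\<^sub>R (0, 0, 1)" by simp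
    ultimately show ?thesis by (simp only: linear_add[OF lh] linear_scale[OF lh]) simp
  qed
  have "((\<lambda>p::(real^'n) \<times> real. g (fst p $ i, snd p)) has_derivative (\<lambda>e. ?Dg (fst e $ i, snd e))) (at 0)"
    using frechet_derivative_compose_linear[OF dg linear_cell_arguments(1), of i 0] by (simp add: zero_prod_def)
  moreover have "((\<lambda>p::(real^'n) \<times> real. h (fst p $ i, fst p $ j, snd p)) has_derivative
      (\<lambda>e. ?Dh (fst e $ i, fst e $ j, snd e))) (at 0)" for j
    using frechet_derivative_compose_linear[OF dh linear_cell_arguments(2), of i j 0] by (simp add: zero_prod_def)
  ultimately have "((\<lambda>p. admissible g h W (fst p) (snd p) $ i) has_derivative
      (\<lambda>e. ?Dg (fst e $ i, snd e) + (\<Sum>j\<in>UNIV. W $ i $ j * ?Dh (fst e $ i, fst e $ j, snd e)))) (at 0)"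
    unfolding admissible_def vec_lambda_beta
    by (intro has_derivative_add has_derivative_sum has_derivative_mult_right)
  from fun_cong[OF frechet_derivative_at[OF this], of "(x, l)"]
  show ?thesis by (simp add: Dg Dh sum_distrib_left mult.left_commute)
qed

lemma jacobian_origin_admissible:
  fixes W :: "real^'n^'n"
  assumes g: "smooth g" and h: "smooth h"
  shows "jacobian_origin (admissible g h W) $ i $ j =
    frechet_derivative (\<lambda>p. admissible g h W (fst p) (snd p) $ i) (at 0) (axis j 1, 0)"
proof -
  let ?D = "\<lambda>i. frechet_derivative (\<lambda>p. admissible g h W (fst p) (snd p) $ i) (at 0)"
  have lin: "linear (\<lambda>x::real^'n. (x, 0::real))" by (auto intro!: linearI)
  have "((\<lambda>x. admissible g h W x 0 $ i) has_derivative (\<lambda>e. ?D i (e, 0))) (at 0)" for i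
    using frechet_derivative_compose_linear[OF
      continuously_differentiable_imp_differentiable[OF continuously_differentiable_admissible[OF g h]] lin,
      of _ i 0]
    by (simp add: zero_prod_def)
  then have "((\<lambda>x. admissible g h W x 0) has_derivative (\<lambda>e. \<chi> i. ?D i (e, 0))) (at 0)"
    unfolding has_derivative_componentwise_within[of "\<lambda>x. admissible g h W x 0"]
    by (auto simp: Basis_vec_def inner_axis)
  from frechet_derivative_at[OF this, symmetric] show ?thesis
    by (simp add: jacobian_origin_def jacobian_def matrix_def)
qed

text \<open>Fixing the parameter at 0 is composition with a linear map. The indices are swapped
  since the inner derivative in \<open>hessian\<close> is taken along the column index, and
  \<open>second_derivative\<close> takes the inner direction first.\<close>

lemma hessian_section:
  fixes f :: "(real^'n) \<times> real \<Rightarrow> real"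
  assumes f: "continuously_differentiable (Suc (Suc k)) f"
  shows "hessian (\<lambda>x. f (x, 0)) 0 $ i $ j = second_derivative f (axis j 1, 0) (axis i 1, 0)"
proof -
  have lin: "linear (\<lambda>x::real^'n. (x, 0::real))" by (auto intro!: linearI)
  have 1: "frechet_derivative (\<lambda>x. f (x, 0)) (at x) = (\<lambda>e. frechet_derivative f (at (x, 0)) (e, 0))" for x
    by (rule frechet_derivative_at[OF frechet_derivative_compose_linear[OF
      continuously_differentiable_imp_differentiable[OF f] lin], symmetric])
  have 2: "frechet_derivative (\<lambda>x. frechet_derivative f (at (x, 0)) e) (at x) =
      (\<lambda>e'. frechet_derivative (\<lambda>p. frechet_derivative f (at p) e) (at (x, 0)) (e', 0))" for x e
    by (rule frechet_derivative_at[OF frechet_derivative_compose_linear[OF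
      continuously_differentiable_imp_differentiable[OF continuously_differentiable_derivative[OF f]] lin], symmetric])
  show ?thesis unfolding hessian_def second_derivative_def vec_lambda_beta 1 2 by (simp add: zero_prod_def)
qed

text \<open>Deleting the row and the column of c amounts to restricting the quadratic form to
  vectors with entry 0 at c.\<close>

lemma quadratic_without_c_hessian:
  fixes f :: "(real^('q::finite option)) \<times> real \<Rightarrow> real"
  assumes f: "continuously_differentiable (Suc (Suc k)) f"
  shows "y \<bullet> (without_c (hessian (\<lambda>x. f (x, 0)) 0) *v y) = second_derivative f (embed y 0, 0) (embed y 0, 0)"
proof -
  have "(embed y 0, 0::real) = (\<Sum>e\<in>UNIV. y $ e *\<^sub>R (axis (Some e) 1, 0))"
    by (simp add: embed_0_eq_sum prod_eq_iff fst_sum snd_sum)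
  then have "second_derivative f (embed y 0, 0) (embed y 0, 0) =
      (\<Sum>(e, d)\<in>UNIV\<times>UNIV. second_derivative f (y $ e *\<^sub>R (axis (Some e) 1, 0)) (y $ d *\<^sub>R (axis (Some d) 1, 0)))"
    by (simp only: bilinear_sum[OF bilinear_second_derivative[OF f]])
  also have "\<dots> = (\<Sum>d\<in>UNIV. \<Sum>e\<in>UNIV. y $ d * (hessian (\<lambda>x. f (x, 0)) 0 $ Some d $ Some e * y $ e))"
    unfolding sum.cartesian_product[symmetric] hessian_section[OF f]
    by (subst sum.swap) (simp only: bilinear_lmul[OF bilinear_second_derivative[OF f]]
        bilinear_rmul[OF bilinear_second_derivative[OF f]] real_scaleR_def mult_ac)
  finally show ?thesis
    by (simp add: inner_vec_def matrix_vector_mult_def without_c_def sum_distrib_left)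
qed

lemma hessian_vector_admissible:
  assumes "smooth g" and "smooth h"
  shows "hessian_vector (admissible g h W) y $ d =
    second_derivative (\<lambda>p. admissible g h W (fst p) (snd p) $ Some d) (embed y 0, 0) (embed y 0, 0)"
  using quadratic_without_c_hessian[OF continuously_differentiable_admissible[OF assms], of y W "Some d"]
  by (simp add: hessian_vector_def)

lemma reduced_jacobian_mult:
  assumes g: "smooth g" and h: "smooth h"
  shows "(without_c (jacobian_origin (admissible g h W)) *v y) $ d =
    frechet_derivative (\<lambda>p. admissible g h W (fst p) (snd p) $ Some d) (at 0) (embed y 0, 0)"
proof -
  let ?D = "frechet_derivative (\<lambda>p. admissible g h W (fst p) (snd p) $ Some d) (at 0)"
  have lin: "linear ?D"
    by (rule linear_frechet_derivative[OF
      continuously_differentiable_imp_differentiable[OF continuously_differentiable_admissible[OF g h]]])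
  have "(embed y 0, 0::real) = (\<Sum>e\<in>UNIV. y $ e *\<^sub>R (axis (Some e) 1, 0))"
    by (simp add: embed_0_eq_sum prod_eq_iff fst_sum snd_sum)
  then have "?D (embed y 0, 0) = (\<Sum>e\<in>UNIV. y $ e * ?D (axis (Some e) 1, 0))"
    by (simp only: linear_sum[OF lin] linear_scale[OF lin] real_scaleR_def)
  then show ?thesis
    by (simp add: matrix_vector_mult_def without_c_def jacobian_origin_admissible[OF g h] mult.commute)
qed

text \<open>This supplies the hypothesis \<open>taylor\<close> of \<open>fold_solutions\<close>.
  Each component is expanded with the share \<open>\<epsilon> / m\<close>, and the norm is bounded
  by the sum of the components. The linear term in \<open>s\<close> comes from the edges leaving c,
  which are the entries of the c-column of the Laplacian.\<close>

lemma downstream_taylor: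
  fixes W :: "real^('q::finite option)^('q option)"
  assumes g: "smooth g" and h: "smooth h" and diff: "diffusive h" and g0: "\<And>l. g (0, l) = 0"
    and \<epsilon>: "\<epsilon> > 0"
  shows "\<exists>\<delta>>0. \<forall>y s l. norm y \<le> \<delta> \<and> \<bar>s\<bar> \<le> \<delta> \<and> \<bar>l\<bar> \<le> \<delta> \<longrightarrow>
    norm (downstream g h W y s l - (without_c (jacobian_origin (admissible g h W)) *v y
      + s *\<^sub>R (deriv (\<lambda>x. h (x, 0, 0)) 0 *\<^sub>R c_column (laplacian W))
      + (1/2) *\<^sub>R hessian_vector (admissible g h W) y)) \<le> \<epsilon> * ((norm y)\<^sup>2 + \<bar>s\<bar> + \<bar>l\<bar>)"
    (is "\<exists>\<delta>>0. \<forall>y s l. _ \<longrightarrow> norm (?R y s l) \<le> _")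
proof -
  let ?f = "\<lambda>d p. admissible g h W (fst p) (snd p) $ Some d"
  define m where "m = real CARD('q)"
  have m: "m > 0" by (simp add: m_def)
  have h0: "h (0, 0, l) = 0" for l using diff by (simp add: diffusive_def)
  have f0: "?f d 0 = 0" for d by (simp add: admissible_def h0 g0)
  have cd: "continuously_differentiable (Suc (Suc 0)) (?f d)" for d
    by (rule continuously_differentiable_admissible[OF g h])
  define P where "P d \<delta> \<longleftrightarrow> (\<forall>p q. norm p \<le> \<delta> \<longrightarrow> norm q \<le> \<delta> \<longrightarrow>
    \<bar>?f d (p + q) - (frechet_derivative (?f d) (at 0) p + frechet_derivative (?f d) (at 0) q
      + second_derivative (?f d) p p / 2)\<bar> \<le> \<epsilon> / m * ((norm p)\<^sup>2 + norm q))" for d \<delta>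
  have "\<exists>\<delta>>0. P d \<delta>" for d
    unfolding P_def
    by (rule taylor_mixed_order[OF cd[of d] f0[of d] divide_pos_pos[OF \<epsilon> m]]) blast
  then obtain \<delta>' where \<delta>': "\<And>d. \<delta>' d > 0" and P: "\<And>d. P d (\<delta>' d)" by metis
  note tay = P[unfolded P_def, rule_format]
  \<comment> \<open>Halved because \<open>q\<close> has two coordinates, \<open>s\<close> and
    \<open>l\<close>, each at most \<open>\<delta>\<close>.\<close>
  define \<delta> where "\<delta> = Min (range \<delta>') / 2"
  have \<delta>: "\<delta> > 0" "2 * \<delta> \<le> \<delta>' d" for d using \<delta>' by (auto simp: \<delta>_def)
  have "norm (?R y s l) \<le> \<epsilon> * ((norm y)\<^sup>2 + \<bar>s\<bar> + \<bar>l\<bar>)"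
    if y: "norm y \<le> \<delta>" and s: "\<bar>s\<bar> \<le> \<delta>" and l: "\<bar>l\<bar> \<le> \<delta>" for y s l
  proof -
    have "\<bar>?R y s l $ d\<bar> \<le> \<epsilon> / m * ((norm y)\<^sup>2 + \<bar>s\<bar> + \<bar>l\<bar>)" for d
    proof -
      define p where "p = (embed y 0, 0::real)"
      define q where "q = (s *\<^sub>R axis None 1 :: real^('q option), l)"
      have pq: "p + q = (embed y s, l)" by (simp add: p_def q_def embed_eq_add[of y s])
      have np: "norm p = norm y" by (simp add: p_def norm_Pair norm_embed_0)
      have nq: "norm q \<le> \<bar>s\<bar> + \<bar>l\<bar>"
        unfolding q_def norm_Pair using sqrt_sum_squares_le_sum_abs[of s l] by (simp add: norm_axis_1)
      have Dq: "frechet_derivative (?f d) (at 0) q = s * (deriv (\<lambda>x. h (x, 0, 0)) 0 * c_column (laplacian W) $ d)"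
        unfolding q_def frechet_derivative_admissible_origin[OF g h diff g0]
        by (simp add: axis_def sum_UNIV_option c_column_def laplacian_def)
      have "\<bar>?f d (p + q) - (frechet_derivative (?f d) (at 0) p + frechet_derivative (?f d) (at 0) q
          + second_derivative (?f d) p p / 2)\<bar> \<le> \<epsilon> / m * ((norm p)\<^sup>2 + norm q)"
        using y s l nq \<delta>(1) \<delta>(2)[of d] by (intro tay) (auto simp: np)
      also have "\<dots> \<le> \<epsilon> / m * ((norm y)\<^sup>2 + \<bar>s\<bar> + \<bar>l\<bar>)"
        using nq \<epsilon> m by (intro mult_left_mono) (auto simp: np)
      finally show ?thesis
        unfolding pq Dq
        by (simp add: downstream_def reduced_jacobian_mult[OF g h] hessian_vector_admissible[OF g h] p_def)
    qed
    then have "(\<Sum>d\<in>UNIV. \<bar>?R y s l $ d\<bar>) \<le> (\<Sum>d\<in>(UNIV::'q set). \<epsilon> / m * ((norm y)\<^sup>2 + \<bar>s\<bar> + \<bar>l\<bar>))"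
      by (intro sum_mono)
    also have "\<dots> = \<epsilon> * ((norm y)\<^sup>2 + \<bar>s\<bar> + \<bar>l\<bar>)" using m by (simp add: m_def)
    finally show ?thesis using norm_le_l1_cart order_trans by blast
  qed
  then show ?thesis using \<delta>(1) by blast
qed

lemma continuous_on_downstream:
  assumes "smooth g" and "smooth h"
  shows "continuous_on UNIV (\<lambda>y. downstream g h W y s l)"
proof -
  have "continuous_on UNIV (\<lambda>y. admissible g h W (embed y s) l $ Some d)" for d
  proof -
    have "continuous_on UNIV (\<lambda>p. admissible g h W (fst p) (snd p) $ Some d)"
      using continuously_differentiable_admissible[OF assms, of 0] by simp
    moreover have "continuous_on UNIV (\<lambda>y. (embed y 0 + s *\<^sub>R axis None 1, l))"
      by (intro continuous_intros linear_continuous_on linear_embed_0[unfolded linear_conv_bounded_linear])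
    ultimately show ?thesis
      using continuous_on_compose2[of UNIV "\<lambda>p. admissible g h W (fst p) (snd p) $ Some d" UNIV
        "\<lambda>y. (embed y 0 + s *\<^sub>R axis None 1, l)"]
      by (simp add: embed_eq_add[of _ s])
  qed
  then show ?thesis unfolding downstream_def by (intro continuous_on_vec_lambda)
qed

lemma continuous_on_hessian_vector: "continuous_on UNIV (hessian_vector F)"
  unfolding hessian_vector_def[abs_def]
  by (intro continuous_on_vec_lambda continuous_intros linear_continuous_on matrix_vector_mul_bounded_linear)

lemma hessian_vector_scaleR: "hessian_vector F (r *\<^sub>R y) = r\<^sup>2 *\<^sub>R hessian_vector F y"
  by (simp add: vec_eq_iff hessian_vector_def matrix_vector_mult_scaleR power2_eq_square)

section \<open>Nonvanishing of the coupling derivative\<close>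

lemma eigenvalue_laplacian_zero:
  fixes W :: "real^'n^'n"
  shows "eigenvalue (laplacian W) 0"
proof -
  let ?x = "(\<chi> i. 1) :: complex^'n"
  have "map_matrix complex_of_real (laplacian W) *v ?x = 0 *s ?x"
    by (simp add: vec_eq_iff matrix_vector_mult_def laplacian_def input_valency_def sum_subtractf
        flip: of_real_sum)
  moreover have "?x \<noteq> 0" by (simp add: vec_eq_iff)
  ultimately show ?thesis unfolding eigenvalue_def by blast
qed

text \<open>By feedforward, \<open>d\<close> sends edges only to itself, so the unit vector at
  \<open>d\<close> is an eigenvector. The self-loop of \<open>d\<close> cancels between valency and
  weight, and the edge from c remains.\<close>

lemma coalescence_eigenvalue_single_downstream:
  fixes c :: "'p::finite" and W1 :: "real^'p^'p"
    and W2 :: "real^('q::finite option)^('q option)"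
  assumes "feedforward W2" and single: "(UNIV :: 'q set) = {d}"
  shows "eigenvalue (laplacian (coalescence c W1 W2)) (complex_of_real (W2 $ Some d $ None))"
proof -
  let ?A = "map_matrix complex_of_real (laplacian (coalescence c W1 W2))"
  let ?x = "axis (Inr d) 1 :: complex^('p + 'q)"
  have col: "(?A *v ?x) $ a = ?A $ a $ Inr d" for a
    by (simp add: matrix_vector_mult_def axis_def if_distrib[of "\<lambda>z. _ * z"] cong: if_cong)
  have "(?A *v ?x) $ a = (complex_of_real (W2 $ Some d $ None) *s ?x) $ a" for a
  proof (cases a)
    case (Inl i)
    then show ?thesis unfolding col using assms(1)
      by (simp add: map_matrix_def laplacian_def coalescence_def axis_def feedforward_def)
  next
    case (Inr e)
    have "e = d" using single by auto
    then show ?thesis unfolding col using Inr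
      by (simp add: map_matrix_def laplacian_def coalescence_def axis_def
          input_valency_def sum_UNIV_sum_type single)
  qed
  then have "?A *v ?x = complex_of_real (W2 $ Some d $ None) *s ?x" by (simp add: vec_eq_iff)
  moreover have "?x \<noteq> 0" by simp
  ultimately show ?thesis unfolding eigenvalue_def by blast
qed

text \<open>If \<open>h\<^sub>1 = 0\<close>, every number satisfies the bifurcation condition and the reduced Jacobian
  vanishes; the rank then leaves a single cell \<open>d\<close> besides \<open>c\<close> in \<open>N\<^sub>2\<close>, and \<open>0\<close> and the weight
  of the edge from \<open>c\<close> to \<open>d\<close> are two eigenvalues.\<close>

lemma coupling_derivative_nonzero:
  fixes W2 :: "real^('q::finite option)^('q option)"
  assumes ff: "feedforward W2" and g: "smooth g" and h: "smooth h" and diff: "diffusive h"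
    and g0: "\<And>l. g (0, l) = 0"
    and uniq: "\<exists>!\<mu>. eigenvalue (laplacian (coalescence c W1 W2)) \<mu> \<and> bifurcation_condition g h \<mu>"
    and rank: "rank (without_c (jacobian_origin (admissible g h W2))) = CARD('q option) - 2"
    and col: "c_column (laplacian W2) \<noteq> 0"
  shows "deriv (\<lambda>x. h (x, 0, 0)) 0 \<noteq> 0"
proof
  assume h1: "deriv (\<lambda>x. h (x, 0, 0)) 0 = 0"
  then have bif: "bifurcation_condition g h \<mu> \<longleftrightarrow> deriv (\<lambda>x. g (x, 0)) 0 = 0" for \<mu>
    by (simp add: bifurcation_condition_def)
  with uniq have gd: "deriv (\<lambda>x. g (x, 0)) 0 = 0" by blast
  have "without_c (jacobian_origin (admissible g h W2)) $ d $ e = 0" for d e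
    by (simp add: without_c_def jacobian_origin_admissible[OF g h]
        frechet_derivative_admissible_origin[OF g h diff g0] gd h1)
  then have "without_c (jacobian_origin (admissible g h W2)) = 0" by (simp add: vec_eq_iff)
  \<comment> \<open>The subtraction is truncated, so the next line also needs that the type
    \<open>'q\<close> is nonempty.\<close>
  then have "CARD('q) - 1 = 0" using rank by simp
  then have "CARD('q) = 1" using zero_less_card_finite[where 'a='q] by linarith
  then obtain d where d: "(UNIV :: 'q set) = {d}" using card_1_singletonE by blast
  have "complex_of_real (W2 $ Some d $ None) = 0"
    using uniq bif gd eigenvalue_laplacian_zero coalescence_eigenvalue_single_downstream[OF ff d] by metis
  then have "c_column (laplacian W2) $ e = 0" for e
    using d by (auto simp: c_column_def laplacian_def)
  then show False using col by (simp add: vec_eq_iff)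
qed

section \<open>Corank one, branch domains and growth rates\<close>

text \<open>The range is a hyperplane, so a single vector outside it raises the dimension to the
  full one.\<close>

lemma span_insert_range_corank_one:
  fixes A :: "real^'n^'n"
  assumes "rank A = CARD('n) - 1" and "x \<notin> range ((*v) A)"
  shows "span (insert x (range ((*v) A))) = UNIV"
proof -
  have span: "span (range ((*v) A)) = range ((*v) A)"
    by (simp add: linear_subspace_image)
  have "x \<notin> span (range ((*v) A))" using assms(2) unfolding span .
  then have "dim (insert x (range ((*v) A))) = dim (range ((*v) A)) + 1"
    by (simp only: dim_insert if_False)
  also have "\<dots> = DIM(real^'n)"
    using assms(1) zero_less_card_finite[where 'a='n] by (simp add: rank_dim_range)
  finally show ?thesis using dim_eq_full by blast
qed

lemma zero_in_branch_domain: "branch_domain D \<Longrightarrow> 0 \<in> D"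
  by (auto simp: branch_domain_def)

lemma branch_domain_inter_right:
  assumes "branch_domain D" "D \<inter> {0..} \<noteq> {0}" "\<epsilon> > 0"
  obtains \<epsilon>' where "\<epsilon>' > 0" "D \<inter> {0..<\<epsilon>} = {0..<\<epsilon>'}"
proof -
  obtain e where "e > 0" "D = {-e<..<e} \<or> D = {0..<e} \<or> D = {-e<..0}"
    using assms(1) by (auto simp: branch_domain_def)
  moreover have "D \<noteq> {-e<..0}" using assms(2) calculation(1) by auto
  ultimately have "D \<inter> {0..<\<epsilon>} = {0..<min e \<epsilon>}" "min e \<epsilon> > 0" using assms(3) by auto
  then show thesis using that by blast
qed

lemma branch_domain_inter_left:
  assumes "branch_domain D" "D \<inter> {..0} \<noteq> {0}" "\<epsilon> > 0"
  obtains \<epsilon>' where "\<epsilon>' > 0" "D \<inter> {-\<epsilon><..0} = {-\<epsilon>'<..0}"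
proof -
  obtain e where "e > 0" "D = {-e<..<e} \<or> D = {0..<e} \<or> D = {-e<..0}"
    using assms(1) by (auto simp: branch_domain_def)
  moreover have "D \<noteq> {0..<e}" using assms(2) calculation(1) by auto
  ultimately have "D \<inter> {-\<epsilon><..0} = {-min e \<epsilon><..0}" "min e \<epsilon> > 0" using assms(3) by auto
  then show thesis using that by blast
qed

text \<open>The assumption \<open>ne\<close> excludes exactly the one-sided domains on the wrong
  side; in all other cases a half-open interval on side \<open>\<sigma>\<close> meets
  \<open>D\<close> in a half-open interval of the same kind.\<close>

lemma branch_domain_inter_half_line:
  assumes D: "branch_domain D" and \<sigma>: "\<sigma> \<in> {1, -1 :: real}"
    and ne: "D \<inter> {l. 0 \<le> \<sigma> * l} \<noteq> {0}" and \<epsilon>: "\<epsilon> > 0"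
  obtains D' where "branch_domain D'" "branch_domain (D \<inter> D')"
    "\<And>l. l \<in> D' \<Longrightarrow> \<bar>l\<bar> < \<epsilon> \<and> (l = 0 \<or> 0 < \<sigma> * l)" "\<exists>l\<in>D \<inter> D'. l \<noteq> 0"
proof (cases "\<sigma> = 1")
  case True
  then have "{l. 0 \<le> \<sigma> * l} = {0..}" by auto
  then obtain \<epsilon>' where e: "\<epsilon>' > 0" "D \<inter> {0..<\<epsilon>} = {0..<\<epsilon>'}"
    using branch_domain_inter_right[OF D _ \<epsilon>] ne by auto
  have "\<exists>l\<in>D \<inter> {0..<\<epsilon>}. l \<noteq> 0" unfolding e(2) using e(1) by (intro bexI[of _ "\<epsilon>'/2"]) auto
  then show thesis using True e \<epsilon>
    by (intro that[of "{0..<\<epsilon>}"]) (auto simp: branch_domain_def)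
next
  case False
  then have s: "\<sigma> = -1" using \<sigma> by auto
  then have "{l. 0 \<le> \<sigma> * l} = {..0}" by auto
  then obtain \<epsilon>' where e: "\<epsilon>' > 0" "D \<inter> {-\<epsilon><..0} = {-\<epsilon>'<..0}"
    using branch_domain_inter_left[OF D _ \<epsilon>] ne by auto
  have "\<exists>l\<in>D \<inter> {-\<epsilon><..0}. l \<noteq> 0" unfolding e(2) using e(1) by (intro bexI[of _ "-\<epsilon>'/2"]) auto
  then show thesis using s e \<epsilon>
    by (intro that[of "{-\<epsilon><..0}"]) (auto simp: branch_domain_def)
qed

text \<open>The error is at most half of the leading term at cell \<open>d\<close>, so that
  component stays between 1/2 and 3/2 of \<alpha> |v_d| sqrt |l|.\<close>

lemma bigtheta_sqrt_of_direction:
  fixes v :: "real^'q"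
  assumes near: "\<And>l. l \<in> D \<Longrightarrow> norm (b l - (\<tau> * \<alpha> * sqrt \<bar>l\<bar>) *\<^sub>R v) \<le> e * sqrt \<bar>l\<bar>"
    and \<tau>: "\<tau> \<in> {1, -1 :: real}" and \<alpha>: "\<alpha> > 0" and e: "e \<le> \<alpha> * \<bar>v $ d\<bar> / 2" and vd: "v $ d \<noteq> 0"
  shows "(\<lambda>l. b l $ d) \<in> \<Theta>[at 0 within D](\<lambda>l. sqrt \<bar>l\<bar>)"
proof (rule bigthetaI')
  show "\<alpha> * \<bar>v $ d\<bar> / 2 > 0" "3 * (\<alpha> * \<bar>v $ d\<bar>) / 2 > 0" using \<alpha> vd by auto
  have "\<alpha> * \<bar>v $ d\<bar> / 2 * sqrt \<bar>l\<bar> \<le> \<bar>b l $ d\<bar> \<and> \<bar>b l $ d\<bar> \<le> 3 * (\<alpha> * \<bar>v $ d\<bar>) / 2 * sqrt \<bar>l\<bar>"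
    if l: "l \<in> D" for l
  proof -
    have "\<bar>b l $ d - \<tau> * \<alpha> * sqrt \<bar>l\<bar> * v $ d\<bar> \<le> e * sqrt \<bar>l\<bar>"
      using order_trans[OF component_le_norm_cart near[OF l], of d] by simp
    also have "\<dots> \<le> \<alpha> * \<bar>v $ d\<bar> / 2 * sqrt \<bar>l\<bar>" using e by (intro mult_right_mono) auto
    finally have 1: "\<bar>b l $ d - \<tau> * \<alpha> * sqrt \<bar>l\<bar> * v $ d\<bar> \<le> \<alpha> * \<bar>v $ d\<bar> / 2 * sqrt \<bar>l\<bar>" .
    have 2: "\<bar>\<tau> * \<alpha> * sqrt \<bar>l\<bar> * v $ d\<bar> = \<alpha> * \<bar>v $ d\<bar> * sqrt \<bar>l\<bar>"
      using \<tau> \<alpha> by (auto simp: abs_mult)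
    have "x / 2 \<le> \<bar>y\<bar> \<and> \<bar>y\<bar> \<le> 3 * x / 2" if "\<bar>y - z\<bar> \<le> x / 2" "\<bar>z\<bar> = x" for x y z :: real
      using that by linarith
    from this[of "b l $ d", OF _ 2] 1 show ?thesis by simp
  qed
  then show "\<forall>\<^sub>F l in at 0 within D. \<alpha> * \<bar>v $ d\<bar> / 2 * norm (sqrt \<bar>l\<bar>) \<le> norm (b l $ d) \<and>
      norm (b l $ d) \<le> 3 * (\<alpha> * \<bar>v $ d\<bar>) / 2 * norm (sqrt \<bar>l\<bar>)"
    by (auto simp: eventually_at_filter)
qed

section \<open>Construction of the two branches\<close>

text \<open>\<open>S\<close> is chosen before \<open>D1\<close> and \<open>b\<close>: the same side
  serves all branches of the first network with slope \<open>\<beta>\<close> at c. The clause on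
  \<open>b21\<close> and \<open>b22\<close> ensures that two different branches are
  obtained.\<close>

theorem proposition3p14:
  fixes c :: "'p::finite"
    and W1 :: "real^'p^'p"
    and W2 :: "real^('q::finite option)^('q option)"
    and g :: "real \<times> real \<Rightarrow> real"
    and h :: "real \<times> real \<times> real \<Rightarrow> real"
    and v :: "real^'q"
    and \<beta> :: real
  defines "N \<equiv> coalescence c W1 W2"
    and "J \<equiv> without_c (jacobian_origin (admissible g h W2))"
  assumes "connected_network W1" and "connected_network W2"
    and "feedforward W2"
    and "smooth g" and "smooth h" and "diffusive h"
    and "\<forall>l. admissible g h N 0 l = 0"
    and "\<exists>!\<mu>. eigenvalue (laplacian N) \<mu> \<and> bifurcation_condition g h \<mu>"
    and "\<exists>\<mu>. eigenvalue (laplacian W1) \<mu> \<and> bifurcation_condition g h \<mu>"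
    and "\<exists>\<mu>. eigenvalue (laplacian W2) \<mu> \<and> bifurcation_condition g h \<mu>"
    and "rank J = CARD('q option) - 2"
    and "v \<noteq> 0" and "J *v v = 0"
    and "\<beta> *\<^sub>R c_column (laplacian W2) \<notin> range ((*v) J)"
    and "hessian_vector (admissible g h W2) v \<notin> range ((*v) J)"
  shows "\<exists>S\<in>{{0..}, {..0}}. \<forall>D1 b.
    bifurcation_branch (admissible g h W1) D1 b \<and>
    ((\<lambda>l. b l $ c) has_real_derivative \<beta>) (at 0 within D1) \<and>
    D1 \<inter> S \<noteq> {0} \<longrightarrow>
    (\<exists>D2 b21 b22.
      branch_domain D2 \<and>
      bifurcation_branch (admissible g h N) (D1 \<inter> D2) (\<lambda>l. join (b l) (b21 l)) \<and>
      bifurcation_branch (admissible g h N) (D1 \<inter> D2) (\<lambda>l. join (b l) (b22 l)) \<and>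
      (\<exists>l\<in>D1 \<inter> D2. b21 l \<noteq> b22 l) \<and>
      (\<forall>d. v $ d \<noteq> 0 \<longrightarrow>
        (\<lambda>l. join (b l) (b21 l) $ Inr d) \<in> \<Theta>[at 0 within (D1 \<inter> D2)](\<lambda>l. sqrt \<bar>l\<bar>) \<and>
        (\<lambda>l. join (b l) (b22 l) $ Inr d) \<in> \<Theta>[at 0 within (D1 \<inter> D2)](\<lambda>l. sqrt \<bar>l\<bar>)))"
proof -
  note ff = assms(5) and g = assms(6) and h = assms(7) and diff = assms(8)
  have h0: "h (0, 0, l) = 0" for l using diff by (simp add: diffusive_def)
  have g0: "g (0, l) = 0" for l
  proof -
    \<comment> \<open>At the origin all coupling terms vanish, so the equation of any single cell
      reads g(0, l) = 0.\<close>
    have "admissible g h N 0 l $ Inl c = 0" using assms(9) by simp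
    then show ?thesis by (simp add: admissible_def h0)
  qed
  have "\<beta> *\<^sub>R c_column (laplacian W2) \<noteq> 0"
    using assms(16) by (metis matrix_vector_mult_0_right rangeI)
  then have col: "c_column (laplacian W2) \<noteq> 0" by auto
  let ?h1 = "deriv (\<lambda>x. h (x, 0, 0)) 0"
  let ?G = "downstream g h W2"
  have h1: "?h1 \<noteq> 0"
    by (rule coupling_derivative_nonzero[OF ff g h diff g0 assms(10)[unfolded N_def] assms(13)[unfolded J_def] col])
  have k: "\<beta> *\<^sub>R (?h1 *\<^sub>R c_column (laplacian W2)) \<notin> range ((*v) J)"
  proof
    assume "\<beta> *\<^sub>R (?h1 *\<^sub>R c_column (laplacian W2)) \<in> range ((*v) J)"
    then obtain z where "\<beta> *\<^sub>R (?h1 *\<^sub>R c_column (laplacian W2)) = J *v z" by blast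
    then have "J *v ((1 / ?h1) *\<^sub>R z) = (1 / ?h1) *\<^sub>R (\<beta> *\<^sub>R (?h1 *\<^sub>R c_column (laplacian W2)))"
      by (simp add: matrix_vector_mult_scaleR)
    also have "\<dots> = \<beta> *\<^sub>R c_column (laplacian W2)" using h1 by simp
    finally show False using assms(16) by (metis rangeI)
  qed
  \<comment> \<open>\<open>'q option\<close> has one element more than \<open>'q\<close>, so the
    rank assumption is corank one for \<open>J\<close>.\<close>
  have rank: "rank J = CARD('q) - 1" using assms(13) by simp
  obtain \<sigma> \<alpha> :: real where \<sigma>: "\<sigma> \<in> {1, -1}" and \<alpha>: "\<alpha> > 0" and
    sol: "\<And>\<tau> \<epsilon>. \<tau> \<in> {1, -1} \<Longrightarrow> \<epsilon> > 0 \<Longrightarrow>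
      \<exists>r>0. \<forall>l s. 0 < \<sigma> * l \<and> \<bar>l\<bar> < r \<and> \<bar>s - \<beta> * l\<bar> \<le> r * \<bar>l\<bar> \<longrightarrow>
        (\<exists>y. ?G y s l = 0 \<and> norm (y - (\<tau> * \<alpha> * sqrt \<bar>l\<bar>) *\<^sub>R v) \<le> \<epsilon> * sqrt \<bar>l\<bar>)"
  proof (rule fold_solutions[where J = "(*v) J" and v = v and Q = "hessian_vector (admissible g h W2)"
        and k = "?h1 *\<^sub>R c_column (laplacian W2)" and \<beta> = \<beta> and G = ?G])
    show "span (insert (hessian_vector (admissible g h W2) v) (range ((*v) J))) = UNIV"
      by (rule span_insert_range_corank_one[OF rank assms(17)])
    show "J *v v = 0" "v \<noteq> 0" by fact+
    show "\<beta> *\<^sub>R ?h1 *\<^sub>R c_column (laplacian W2) \<notin> range ((*v) J)" by (rule k)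
    show "continuous_on UNIV (\<lambda>y. ?G y s l)" for s l by (rule continuous_on_downstream[OF g h])
    show "\<exists>\<delta>>0. \<forall>y s l. norm y \<le> \<delta> \<and> \<bar>s\<bar> \<le> \<delta> \<and> \<bar>l\<bar> \<le> \<delta> \<longrightarrow>
        norm (?G y s l - (J *v y + s *\<^sub>R ?h1 *\<^sub>R c_column (laplacian W2)
          + (1/2) *\<^sub>R hessian_vector (admissible g h W2) y)) \<le> \<epsilon> * ((norm y)\<^sup>2 + \<bar>s\<bar> + \<bar>l\<bar>)"
      if "\<epsilon> > 0" for \<epsilon> unfolding J_def by (rule downstream_taylor[OF g h diff g0 that])
  qed (auto simp: continuous_on_hessian_vector hessian_vector_scaleR)
  define S where "S = {l. 0 \<le> \<sigma> * l}"
  have S: "S \<in> {{0..}, {..0}}" using \<sigma> by (auto simp: S_def)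
  have "\<exists>D2 b21 b22.
      branch_domain D2 \<and>
      bifurcation_branch (admissible g h N) (D1 \<inter> D2) (\<lambda>l. join (b l) (b21 l)) \<and>
      bifurcation_branch (admissible g h N) (D1 \<inter> D2) (\<lambda>l. join (b l) (b22 l)) \<and>
      (\<exists>l\<in>D1 \<inter> D2. b21 l \<noteq> b22 l) \<and>
      (\<forall>d. v $ d \<noteq> 0 \<longrightarrow>
        (\<lambda>l. join (b l) (b21 l) $ Inr d) \<in> \<Theta>[at 0 within (D1 \<inter> D2)](\<lambda>l. sqrt \<bar>l\<bar>) \<and>
        (\<lambda>l. join (b l) (b22 l) $ Inr d) \<in> \<Theta>[at 0 within (D1 \<inter> D2)](\<lambda>l. sqrt \<bar>l\<bar>))"
    if b: "bifurcation_branch (admissible g h W1) D1 b"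
      and der: "((\<lambda>l. b l $ c) has_real_derivative \<beta>) (at 0 within D1)"
      and D1S: "D1 \<inter> S \<noteq> {0}" for D1 b
  proof -
    have D1: "branch_domain D1" and b0: "b 0 = 0" and eq: "\<And>l. l \<in> D1 \<Longrightarrow> admissible g h W1 (b l) l = 0"
      using b by (auto simp: bifurcation_branch_def equilibrium_branch_def)
    \<comment> \<open>The entry with \<open>norm v\<close> will make the branches nonzero and
      distinct, the others give the growth rate at every cell \<open>d\<close> with
      \<open>v $ d\<close> nonzero.\<close>
    define e where "e = Min (insert (\<alpha> * norm v / 2) ((\<lambda>d. \<alpha> * \<bar>v $ d\<bar> / 2) ` {d. v $ d \<noteq> 0}))"
    have e0: "e > 0" using \<alpha> \<open>v \<noteq> 0\<close> by (auto simp: e_def)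
    have ev: "e \<le> \<alpha> * norm v / 2" unfolding e_def by (rule Min_le) auto
    have ed: "e \<le> \<alpha> * \<bar>v $ d\<bar> / 2" if "v $ d \<noteq> 0" for d
      unfolding e_def using that by (intro Min_le) auto
    obtain r1 r2 where r: "r1 > 0" "r2 > 0" and
      sol1: "\<And>l s. 0 < \<sigma> * l \<Longrightarrow> \<bar>l\<bar> < r1 \<Longrightarrow> \<bar>s - \<beta> * l\<bar> \<le> r1 * \<bar>l\<bar> \<Longrightarrow>
        \<exists>y. ?G y s l = 0 \<and> norm (y - (1 * \<alpha> * sqrt \<bar>l\<bar>) *\<^sub>R v) \<le> e * sqrt \<bar>l\<bar>" and
      sol2: "\<And>l s. 0 < \<sigma> * l \<Longrightarrow> \<bar>l\<bar> < r2 \<Longrightarrow> \<bar>s - \<beta> * l\<bar> \<le> r2 * \<bar>l\<bar> \<Longrightarrow>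
        \<exists>y. ?G y s l = 0 \<and> norm (y - ((-1) * \<alpha> * sqrt \<bar>l\<bar>) *\<^sub>R v) \<le> e * sqrt \<bar>l\<bar>"
      using sol[of 1 e] sol[of "-1" e] e0 by blast
    define r where "r = min r1 r2"
    have r0: "r > 0" "r \<le> r1" "r \<le> r2" using r by (auto simp: r_def)
    have "((\<lambda>l. b l $ c) has_derivative (*) \<beta>) (at 0 within D1)"
      using der by (simp add: has_field_derivative_def)
    \<comment> \<open>As \<open>b 0 = 0\<close>, differentiability at 0 is precisely the closeness
      of \<open>s\<close> to \<open>\<beta> * l\<close> that \<open>sol\<close> demands.\<close>
    then obtain \<delta> where \<delta>: "\<delta> > 0" and dif: "\<And>l. l \<in> D1 \<Longrightarrow> \<bar>l\<bar> < \<delta> \<Longrightarrow> \<bar>b l $ c - \<beta> * l\<bar> \<le> r * \<bar>l\<bar>"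
      using r0(1) unfolding has_derivative_within_alt by (auto simp: b0 dest!: spec[of _ r])
    obtain D2 where D2: "branch_domain D2" and D12: "branch_domain (D1 \<inter> D2)" and
      D2l: "\<And>l. l \<in> D2 \<Longrightarrow> \<bar>l\<bar> < min r \<delta> \<and> (l = 0 \<or> 0 < \<sigma> * l)" and nz: "\<exists>l\<in>D1 \<inter> D2. l \<noteq> 0"
      using branch_domain_inter_half_line[OF D1 \<sigma> D1S[unfolded S_def], of "min r \<delta>"] r0(1) \<delta> by auto
    have G0: "?G 0 0 0 = 0"
      by (simp add: vec_eq_iff downstream_def admissible_def h0 g0 sum_UNIV_option)
    \<comment> \<open>At \<open>l = 0\<close> the bound forces \<open>y = 0\<close>, which is a
      solution; this yields the branch value 0 there.\<close>
    have ex: "\<exists>y. ?G y (b l $ c) l = 0 \<and> norm (y - (\<tau> * \<alpha> * sqrt \<bar>l\<bar>) *\<^sub>R v) \<le> e * sqrt \<bar>l\<bar>"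
      if l: "l \<in> D1 \<inter> D2" and \<tau>: "\<tau> \<in> {1, -1}" for l \<tau>
    proof (cases "l = 0")
      case True
      then show ?thesis using G0 by (intro exI[of _ 0]) (simp add: b0)
    next
      case False
      then have pos: "0 < \<sigma> * l" and small: "\<bar>l\<bar> < r" "\<bar>l\<bar> < \<delta>" using D2l l by auto
      have "\<bar>b l $ c - \<beta> * l\<bar> \<le> r * \<bar>l\<bar>" using dif small l by blast
      moreover have "r * \<bar>l\<bar> \<le> r1 * \<bar>l\<bar>" "r * \<bar>l\<bar> \<le> r2 * \<bar>l\<bar>" using r0 by (auto intro: mult_right_mono)
      ultimately have "\<bar>b l $ c - \<beta> * l\<bar> \<le> r1 * \<bar>l\<bar>" "\<bar>b l $ c - \<beta> * l\<bar> \<le> r2 * \<bar>l\<bar>" by linarith+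
      then show ?thesis using sol1[OF pos] sol2[OF pos] small r0 \<tau> by auto
    qed
    \<comment> \<open>The solutions are chosen independently for each \<open>l\<close>; the norm
      bound alone ties them to the direction \<open>\<tau> *\<^sub>R v\<close>.\<close>
    define B where "B \<tau> l = (SOME y. ?G y (b l $ c) l = 0 \<and>
      norm (y - (\<tau> * \<alpha> * sqrt \<bar>l\<bar>) *\<^sub>R v) \<le> e * sqrt \<bar>l\<bar>)" for \<tau> l
    have B: "?G (B \<tau> l) (b l $ c) l = 0"
      and Bn: "norm (B \<tau> l - (\<tau> * \<alpha> * sqrt \<bar>l\<bar>) *\<^sub>R v) \<le> e * sqrt \<bar>l\<bar>"
      if "\<tau> \<in> {1, -1}" "l \<in> D1 \<inter> D2" for \<tau> l
      using someI_ex[OF ex[OF that(2,1)]] unfolding B_def[symmetric] by (rule conjunct1, rule conjunct2)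
    have zeroD: "0 \<in> D1 \<inter> D2" using D12 by (rule zero_in_branch_domain)
    have Bv: "norm (B \<tau> l - (\<tau> * \<alpha> * sqrt \<bar>l\<bar>) *\<^sub>R v) \<le> \<alpha> * sqrt \<bar>l\<bar> * norm v / 2"
      if "\<tau> \<in> {1, -1}" "l \<in> D1 \<inter> D2" for \<tau> l
      using order_trans[OF Bn[OF that] mult_right_mono[OF ev, of "sqrt \<bar>l\<bar>"]] by (simp add: mult_ac)
    have pos: "\<alpha> * sqrt \<bar>l\<bar> * norm v > 0" if "l \<noteq> 0" for l
      using that \<alpha> \<open>v \<noteq> 0\<close> by simp
    obtain l\<^sub>0 where l0: "l\<^sub>0 \<in> D1 \<inter> D2" "l\<^sub>0 \<noteq> 0" using nz by blast
    have branch: "bifurcation_branch (admissible g h N) (D1 \<inter> D2) (\<lambda>l. join (b l) (B \<tau> l))"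
      if \<tau>: "\<tau> \<in> {1, -1}" for \<tau>
    proof -
      have j0: "join 0 0 = 0" by (simp add: vec_eq_iff join_def split: sum.split)
      have "admissible g h N (join (b l) (B \<tau> l)) l = 0" if l: "l \<in> D1 \<inter> D2" for l
        using l B[OF \<tau> l] eq[of l] by (simp add: N_def admissible_coalescence[OF ff diff] j0)
      moreover have "B \<tau> 0 = 0" using Bn[OF \<tau> zeroD] by simp
      moreover have "B \<tau> l\<^sub>0 \<noteq> 0"
      proof
        assume "B \<tau> l\<^sub>0 = 0"
        then have "norm ((\<tau> * \<alpha> * sqrt \<bar>l\<^sub>0\<bar>) *\<^sub>R v) \<le> \<alpha> * sqrt \<bar>l\<^sub>0\<bar> * norm v / 2"
          using Bv[OF \<tau> l0(1)] by simp
        moreover have "norm ((\<tau> * \<alpha> * sqrt \<bar>l\<^sub>0\<bar>) *\<^sub>R v) = \<alpha> * sqrt \<bar>l\<^sub>0\<bar> * norm v"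
          using \<tau> \<alpha> by (auto simp: abs_mult)
        ultimately show False using pos[OF l0(2)] by linarith
      qed
      then have "join (b l\<^sub>0) (B \<tau> l\<^sub>0) \<noteq> 0"
        by (auto simp: vec_eq_iff join_def split: sum.split_asm dest: spec[of _ "Inr _"])
      ultimately show ?thesis
        using D12 l0(1) unfolding bifurcation_branch_def equilibrium_branch_def by (auto simp: b0 j0)
    qed
    \<comment> \<open>If the two values agreed, 2 \<alpha> sqrt |l| v would be a difference of two
      errors, each of norm at most a quarter of its norm.\<close>
    have neq: "B 1 l\<^sub>0 \<noteq> B (-1) l\<^sub>0"
    proof
      assume "B 1 l\<^sub>0 = B (-1) l\<^sub>0"
      then have "(2 * (\<alpha> * sqrt \<bar>l\<^sub>0\<bar>)) *\<^sub>R v =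
          (B (-1) l\<^sub>0 - ((-1) * \<alpha> * sqrt \<bar>l\<^sub>0\<bar>) *\<^sub>R v) - (B 1 l\<^sub>0 - (1 * \<alpha> * sqrt \<bar>l\<^sub>0\<bar>) *\<^sub>R v)"
        by (simp add: scaleR_2 flip: scaleR_scaleR)
      then have "norm ((2 * (\<alpha> * sqrt \<bar>l\<^sub>0\<bar>)) *\<^sub>R v) \<le> \<alpha> * sqrt \<bar>l\<^sub>0\<bar> * norm v / 2 + \<alpha> * sqrt \<bar>l\<^sub>0\<bar> * norm v / 2"
        using norm_triangle_le_diff[OF add_mono[OF Bv[of "-1" l\<^sub>0] Bv[of 1 l\<^sub>0]]] l0(1) by simp
      moreover have "norm ((2 * (\<alpha> * sqrt \<bar>l\<^sub>0\<bar>)) *\<^sub>R v) = 2 * (\<alpha> * sqrt \<bar>l\<^sub>0\<bar> * norm v)"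
        using \<alpha> by (simp add: abs_mult)
      ultimately show False using pos[OF l0(2)] by linarith
    qed
    have growth: "(\<lambda>l. join (b l) (B \<tau> l) $ Inr d) \<in> \<Theta>[at 0 within (D1 \<inter> D2)](\<lambda>l. sqrt \<bar>l\<bar>)"
      if "v $ d \<noteq> 0" "\<tau> \<in> {1, -1}" for d \<tau>
      using bigtheta_sqrt_of_direction[where D = "D1 \<inter> D2", OF Bn[OF that(2)] that(2) \<alpha> ed[OF that(1)] that(1)]
      by (simp add: join_def)
    show ?thesis
    proof (rule exI[of _ D2], rule exI[of _ "B 1"], rule exI[of _ "B (-1)"], intro conjI allI impI)
      show "branch_domain D2" by (rule D2)
      show "bifurcation_branch (admissible g h N) (D1 \<inter> D2) (\<lambda>l. join (b l) (B 1 l))"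
        "bifurcation_branch (admissible g h N) (D1 \<inter> D2) (\<lambda>l. join (b l) (B (-1) l))"
        by (rule branch, simp)+
      show "\<exists>l\<in>D1 \<inter> D2. B 1 l \<noteq> B (-1) l" using neq l0(1) by blast
      fix d assume "v $ d \<noteq> 0"
      then show "(\<lambda>l. join (b l) (B 1 l) $ Inr d) \<in> \<Theta>[at 0 within (D1 \<inter> D2)](\<lambda>l. sqrt \<bar>l\<bar>)"
        "(\<lambda>l. join (b l) (B (-1) l) $ Inr d) \<in> \<Theta>[at 0 within (D1 \<inter> D2)](\<lambda>l. sqrt \<bar>l\<bar>)"
        by (rule growth, simp)+
    qed
  qed
  then show ?thesis
    by (intro bexI[OF _ S] allI impI) (elim conjE)
qed

end
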